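(* Let $X$ and $Y$ be real Banach spaces of dimension at least two, with $X$ uniformly convex. Then the pair $(c_0(X),Y)$ satisfies the BPBp-RSE if and only if $Y$ is uniformly convex. Likewise, for $m\in\mathbb N$, $m\ge2$, the pair $(\ell_\infty^m(X),Y)$ satisfies the BPBp-RSE if and only if $Y$ is uniformly convex.
   Context: All Banach spaces here are real; $B_X$, $S_X$ are the closed unit ball and unit sphere of $X$; $\mathbb T=\{1,-1\}$; $\mathcal L(X,Y)$ is the space of bounded linear operators. $c_0(X)$ is the space of sequences in $X$ converging to $0$ in norm, with the supremum norm; $\ell_\infty^m(X)$ is $X^m$ with the maximum norm. An operator $T\in\mathcal L(Z,Y)$ is range strongly exposing, $T\in\mathrm{RSE}(Z,Y)$, if there is $x_0\in S_Z$ such that whenever $(x_n)\subseteq B_Z$ satisfies $\|Tx_n\|\to\|T\|$, there are a subsequence $(x_{\sigma(n)})$ and $\lambda\in\mathbb T$ with $Tx_{\sigma(n)}\to\lambda Tx_0$. The pair $(Z,Y)$ has the BPBp-RSE if for every $\varepsilon>0$ there is $0<\eta(\varepsilon)<\varepsilon$ such that for every $T\in\mathcal L(Z,Y)$ with $\|T\|=1$ and every $x\in S_Z$ with $\|Tx\|>1-\eta(\varepsilon)$, there exist $S\in\mathrm{RSE}(Z,Y)$ and $x_0\in S_Z$ with $\|S\|=\|Sx_0\|=1$, $\|S-T\|<\varepsilon$ and $\|x-x_0\|<\varepsilon$. A Banach space $Y$ is uniformly convex if for every $\varepsilon>0$ there is $0<\delta<1$ such that $y_1,y_2\in S_Y$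 and $\|y_1+y_2\|/2>1-\delta$ imply $\|y_1-y_2\|<\varepsilon$. *)

theory Defs
  imports "HOL-Analysis.Analysis"
begin

typedef (overloaded) ('a::real_normed_vector) c0 = "{f :: nat \<Rightarrow> 'a. f \<longlonglongrightarrow> 0}"
  morphisms c0_nth Abs_c0
  by (intro exI[of _ "\<lambda>_. 0"]) simp

setup_lifting type_definition_c0

lemma c0_nth_tendsto: "c0_nth f \<longlonglongrightarrow> 0"
  using c0_nth[of f] by simp

lemma c0_eqI: "(\<And>n. c0_nth f n = c0_nth g n) \<Longrightarrow> f = g"
  by transfer auto

lemma c0_bdd_above: "bdd_above (range (\<lambda>n. norm (c0_nth f n)))"
proof -
  have "Bseq (c0_nth f)"
    using c0_nth_tendsto convergentI convergent_imp_Bseq by blast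
  then obtain K where "\<And>n. norm (c0_nth f n) \<le> K"
    unfolding Bseq_def by blast
  then show ?thesis by (auto intro!: bdd_aboveI)
qed

instantiation c0 :: (real_normed_vector) real_normed_vector
begin

lift_definition zero_c0 :: "'a c0" is "\<lambda>_. 0" by simp
lift_definition plus_c0 :: "'a c0 \<Rightarrow> 'a c0 \<Rightarrow> 'a c0" is "\<lambda>f g n. f n + g n"
  using tendsto_add_zero by blast
lift_definition uminus_c0 :: "'a c0 \<Rightarrow> 'a c0" is "\<lambda>f n. - f n"
  using tendsto_minus by fastforce
lift_definition minus_c0 :: "'a c0 \<Rightarrow> 'a c0 \<Rightarrow> 'a c0" is "\<lambda>f g n. f n - g n"
  using tendsto_diff by fastforce
lift_definition scaleR_c0 :: "real \<Rightarrow> 'a c0 \<Rightarrow> 'a c0" is "\<lambda>r f n. r *\<^sub>R f n"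
  using tendsto_scaleR[OF tendsto_const] by fastforce

definition norm_c0 :: "'a c0 \<Rightarrow> real" where
  "norm_c0 f = (SUP n. norm (c0_nth f n))"
definition dist_c0 :: "'a c0 \<Rightarrow> 'a c0 \<Rightarrow> real" where
  "dist_c0 f g = norm (f - g)"
definition sgn_c0 :: "'a c0 \<Rightarrow> 'a c0" where
  "sgn_c0 f = inverse (norm f) *\<^sub>R f"
definition uniformity_c0 :: "('a c0 \<times> 'a c0) filter" where
  "uniformity_c0 = (INF e\<in>{0<..}. principal {(f, g). dist f g < e})"
definition open_c0 :: "'a c0 set \<Rightarrow> bool" where
  "open_c0 U = (\<forall>f\<in>U. \<forall>\<^sub>F (f', g) in uniformity. f' = f \<longrightarrow> g \<in> U)"

lemma norm_c0_nth_le: "norm (c0_nth f n) \<le> norm f"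
  unfolding norm_c0_def by (rule cSUP_upper[OF UNIV_I c0_bdd_above])

lemma norm_c0_le: "(\<And>n. norm (c0_nth f n) \<le> K) \<Longrightarrow> norm f \<le> K"
  unfolding norm_c0_def by (rule cSUP_least) auto

instance
proof
  fix f g :: "'a c0" and r :: real
  show "norm f = 0 \<longleftrightarrow> f = 0"
  proof
    assume "norm f = 0"
    then show "f = 0"
      using norm_c0_nth_le[of f] by (intro c0_eqI) (simp add: zero_c0.rep_eq)
  next
    assume "f = 0"
    then show "norm f = 0"
      unfolding norm_c0_def by (simp add: zero_c0.rep_eq)
  qed
  show "norm (f + g) \<le> norm f + norm g"
    by (rule norm_c0_le)
      (simp add: plus_c0.rep_eq norm_triangle_le add_mono norm_c0_nth_le)
  show "norm (r *\<^sub>R f) = \<bar>r\<bar> * norm f"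
  proof (rule antisym)
    show "norm (r *\<^sub>R f) \<le> \<bar>r\<bar> * norm f"
      by (rule norm_c0_le) (simp add: scaleR_c0.rep_eq mult_left_mono norm_c0_nth_le)
    show "\<bar>r\<bar> * norm f \<le> norm (r *\<^sub>R f)"
    proof (cases "r = 0")
      case True
      then show ?thesis
        using order_trans[OF norm_ge_zero norm_c0_nth_le[of "r *\<^sub>R f" 0]] by simp
    next
      case False
      have "norm f \<le> norm (r *\<^sub>R f) / \<bar>r\<bar>"
      proof (rule norm_c0_le)
        fix n
        have "\<bar>r\<bar> * norm (c0_nth f n) \<le> norm (r *\<^sub>R f)"
          using norm_c0_nth_le[of "r *\<^sub>R f" n] by (simp add: scaleR_c0.rep_eq)
        then show "norm (c0_nth f n) \<le> norm (r *\<^sub>R f) / \<bar>r\<bar>"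
          using False by (simp add: field_simps)
      qed
      then show ?thesis using False by (simp add: field_simps)
    qed
  qed
qed (simp_all add: dist_c0_def sgn_c0_def uniformity_c0_def open_c0_def,
     (transfer; simp add: algebra_simps fun_eq_iff)+)

end

instance c0 :: (banach) banach
proof
  fix X :: "nat \<Rightarrow> 'a c0"
  assume "Cauchy X"
  have Cau: "\<exists>M. \<forall>m\<ge>M. \<forall>n\<ge>M. \<forall>k. norm (c0_nth (X m) k - c0_nth (X n) k) < e" if "e > 0" for e
  proof -
    obtain M where M: "\<And>m n. m \<ge> M \<Longrightarrow> n \<ge> M \<Longrightarrow> norm (X m - X n) < e"
      using \<open>Cauchy X\<close> \<open>e > 0\<close> unfolding Cauchy_def dist_norm by blast
    then show ?thesis
      by (metis minus_c0.rep_eq norm_c0_nth_le order_le_less_trans)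
  qed
  have "Cauchy (\<lambda>m. c0_nth (X m) k)" for k
    unfolding Cauchy_def dist_norm using Cau by meson
  then have "\<forall>k. \<exists>l. (\<lambda>m. c0_nth (X m) k) \<longlonglongrightarrow> l"
    by (simp add: Cauchy_convergent_iff convergent_def)
  then obtain g where g: "\<And>k. (\<lambda>m. c0_nth (X m) k) \<longlonglongrightarrow> g k"
    by metis
  have unif: "\<exists>M. \<forall>m\<ge>M. \<forall>k. norm (c0_nth (X m) k - g k) \<le> e" if "e > 0" for e
  proof -
    obtain M where M: "\<And>m n k. m \<ge> M \<Longrightarrow> n \<ge> M \<Longrightarrow> norm (c0_nth (X m) k - c0_nth (X n) k) < e"
      using Cau[OF \<open>e > 0\<close>] by blast
    have "norm (c0_nth (X m) k - g k) \<le> e" if "m \<ge> M" for m k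
    proof (rule LIMSEQ_le_const2)
      show "(\<lambda>n. norm (c0_nth (X m) k - c0_nth (X n) k)) \<longlonglongrightarrow> norm (c0_nth (X m) k - g k)"
        by (intro tendsto_intros g)
      show "\<exists>N. \<forall>n\<ge>N. norm (c0_nth (X m) k - c0_nth (X n) k) \<le> e"
        using M[OF that] by (meson less_imp_le)
    qed
    then show ?thesis by blast
  qed
  have "g \<longlonglongrightarrow> 0"
  proof (rule LIMSEQ_I)
    fix e :: real assume "e > 0"
    then obtain M where M: "\<And>k. norm (c0_nth (X M) k - g k) \<le> e / 2"
      using unif[of "e / 2"] by auto
    obtain N where N: "\<And>k. k \<ge> N \<Longrightarrow> norm (c0_nth (X M) k) < e / 2"
      using LIMSEQ_D[OF c0_nth_tendsto[of "X M"], of "e / 2"] \<open>e > 0\<close> by auto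
    have "norm (g k - 0) < e" if "k \<ge> N" for k
    proof -
      have "norm (g k) \<le> norm (c0_nth (X M) k) + norm (c0_nth (X M) k - g k)"
        by (metis add.commute norm_minus_commute norm_triangle_sub)
      then show ?thesis using N[OF that] M[of k] by simp
    qed
    then show "\<exists>N. \<forall>k\<ge>N. norm (g k - 0) < e" by blast
  qed
  then have nth: "c0_nth (Abs_c0 g) = g"
    by (simp add: Abs_c0_inverse)
  have "X \<longlonglongrightarrow> Abs_c0 g"
  proof (rule LIMSEQ_I)
    fix e :: real assume "e > 0"
    then obtain M where M: "\<And>m k. m \<ge> M \<Longrightarrow> norm (c0_nth (X m) k - g k) \<le> e / 2"
      using unif[of "e / 2"] by auto
    have "norm (X m - Abs_c0 g) \<le> e / 2" if "m \<ge> M" for m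
      by (rule norm_c0_le) (use M[OF that] in \<open>simp add: minus_c0.rep_eq nth\<close>)
    then show "\<exists>M. \<forall>m\<ge>M. norm (X m - Abs_c0 g) < e"
      using order_le_less_trans[of _ "e / 2" e] \<open>e > 0\<close> by force
  qed
  then show "convergent X" by (rule convergentI)
qed

text \<open>The number \<open>m\<close> of coordinates is the cardinality of the finite index type \<open>'m\<close>.
  The type \<open>'a ^ 'm\<close> cannot be used, since it carries the Euclidean norm.\<close>

typedef ('a, 'm) linf = "UNIV :: ('m \<Rightarrow> 'a) set"
  morphisms linf_nth Abs_linf
  by simp

setup_lifting type_definition_linf

lemma linf_eqI: "(\<And>i. linf_nth f i = linf_nth g i) \<Longrightarrow> f = g"
  by transfer auto

instantiation linf :: (real_normed_vector, finite) real_normed_vector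
begin

lift_definition zero_linf :: "('a, 'b) linf" is "\<lambda>_. 0" .
lift_definition plus_linf :: "('a, 'b) linf \<Rightarrow> ('a, 'b) linf \<Rightarrow> ('a, 'b) linf"
  is "\<lambda>f g i. f i + g i" .
lift_definition uminus_linf :: "('a, 'b) linf \<Rightarrow> ('a, 'b) linf" is "\<lambda>f i. - f i" .
lift_definition minus_linf :: "('a, 'b) linf \<Rightarrow> ('a, 'b) linf \<Rightarrow> ('a, 'b) linf"
  is "\<lambda>f g i. f i - g i" .
lift_definition scaleR_linf :: "real \<Rightarrow> ('a, 'b) linf \<Rightarrow> ('a, 'b) linf"
  is "\<lambda>r f i. r *\<^sub>R f i" .

definition norm_linf :: "('a, 'b) linf \<Rightarrow> real" where
  "norm_linf f = Max (range (\<lambda>i. norm (linf_nth f i)))"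
definition dist_linf :: "('a, 'b) linf \<Rightarrow> ('a, 'b) linf \<Rightarrow> real" where
  "dist_linf f g = norm (f - g)"
definition sgn_linf :: "('a, 'b) linf \<Rightarrow> ('a, 'b) linf" where
  "sgn_linf f = inverse (norm f) *\<^sub>R f"
definition uniformity_linf :: "(('a, 'b) linf \<times> ('a, 'b) linf) filter" where
  "uniformity_linf = (INF e\<in>{0<..}. principal {(f, g). dist f g < e})"
definition open_linf :: "('a, 'b) linf set \<Rightarrow> bool" where
  "open_linf U = (\<forall>f\<in>U. \<forall>\<^sub>F (f', g) in uniformity. f' = f \<longrightarrow> g \<in> U)"

lemma norm_linf_nth_le: "norm (linf_nth f i) \<le> norm f"
  unfolding norm_linf_def by (rule Max_ge) auto

lemma norm_linf_le: "(\<And>i. norm (linf_nth f i) \<le> K) \<Longrightarrow> norm f \<le> K"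
  unfolding norm_linf_def by (rule Max.boundedI) auto

instance
proof
  fix f g :: "('a, 'b) linf" and r :: real
  show "norm f = 0 \<longleftrightarrow> f = 0"
  proof
    assume "norm f = 0"
    then show "f = 0"
      using norm_linf_nth_le[of f] by (intro linf_eqI) (simp add: zero_linf.rep_eq)
  next
    assume "f = 0"
    then show "norm f = 0"
      unfolding norm_linf_def by (simp add: zero_linf.rep_eq)
  qed
  show "norm (f + g) \<le> norm f + norm g"
    by (rule norm_linf_le)
      (simp add: plus_linf.rep_eq norm_triangle_le add_mono norm_linf_nth_le)
  show "norm (r *\<^sub>R f) = \<bar>r\<bar> * norm f"
  proof (rule antisym)
    show "norm (r *\<^sub>R f) \<le> \<bar>r\<bar> * norm f"
      by (rule norm_linf_le) (simp add: scaleR_linf.rep_eq mult_left_mono norm_linf_nth_le)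
    show "\<bar>r\<bar> * norm f \<le> norm (r *\<^sub>R f)"
    proof (cases "r = 0")
      case True
      then show ?thesis
        using order_trans[OF norm_ge_zero norm_linf_nth_le[of "r *\<^sub>R f" undefined]] by simp
    next
      case False
      have "norm f \<le> norm (r *\<^sub>R f) / \<bar>r\<bar>"
      proof (rule norm_linf_le)
        fix i
        have "\<bar>r\<bar> * norm (linf_nth f i) \<le> norm (r *\<^sub>R f)"
          using norm_linf_nth_le[of "r *\<^sub>R f" i] by (simp add: scaleR_linf.rep_eq)
        then show "norm (linf_nth f i) \<le> norm (r *\<^sub>R f) / \<bar>r\<bar>"
          using False by (simp add: field_simps)
      qed
      then show ?thesis using False by (simp add: field_simps)
    qed
  qed
qed (simp_all add: dist_linf_def sgn_linf_def uniformity_linf_def open_linf_def,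
     (transfer; simp add: algebra_simps fun_eq_iff)+)

end

instance linf :: (banach, finite) banach
proof
  fix X :: "nat \<Rightarrow> ('a, 'b) linf"
  assume "Cauchy X"
  have "Cauchy (\<lambda>m. linf_nth (X m) i)" for i
    unfolding Cauchy_def dist_norm
  proof (intro allI impI)
    fix e :: real assume "e > 0"
    then obtain M where "\<And>m n. m \<ge> M \<Longrightarrow> n \<ge> M \<Longrightarrow> norm (X m - X n) < e"
      using \<open>Cauchy X\<close> unfolding Cauchy_def dist_norm by blast
    then show "\<exists>M. \<forall>m\<ge>M. \<forall>n\<ge>M. norm (linf_nth (X m) i - linf_nth (X n) i) < e"
      by (metis minus_linf.rep_eq norm_linf_nth_le order_le_less_trans)
  qed
  then have "\<forall>i. \<exists>l. (\<lambda>m. linf_nth (X m) i) \<longlonglongrightarrow> l"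
    by (simp add: Cauchy_convergent_iff convergent_def)
  then obtain g where g: "\<And>i. (\<lambda>m. linf_nth (X m) i) \<longlonglongrightarrow> g i"
    by metis
  have "X \<longlonglongrightarrow> Abs_linf g"
  proof (rule LIMSEQ_I)
    fix e :: real assume "e > 0"
    have "\<forall>\<^sub>F m in sequentially. \<forall>i. norm (linf_nth (X m) i - g i) < e / 2"
    proof (rule eventually_all_finite)
      fix i
      show "\<forall>\<^sub>F m in sequentially. norm (linf_nth (X m) i - g i) < e / 2"
        using tendstoD[OF g[of i], of "e / 2"] \<open>e > 0\<close> by (simp add: dist_norm)
    qed
    then obtain M where M: "\<And>m i. m \<ge> M \<Longrightarrow> norm (linf_nth (X m) i - g i) < e / 2"
      unfolding eventually_sequentially by blast
    have "norm (X m - Abs_linf g) \<le> e / 2" if "m \<ge> M" for m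
      by (rule norm_linf_le) (use M[OF that] in \<open>simp add: minus_linf.rep_eq Abs_linf_inverse less_imp_le\<close>)
    then show "\<exists>M. \<forall>m\<ge>M. norm (X m - Abs_linf g) < e"
      using order_le_less_trans[of _ "e / 2" e] \<open>e > 0\<close> by force
  qed
  then show "convergent X" by (rule convergentI)
qed

text \<open>The library's \<open>dim\<close> is \<open>0\<close> on infinite-dimensional spaces, so it cannot express
  that a Banach space has dimension at least two.\<close>

definition dim_at_least_two :: "'a::real_vector itself \<Rightarrow> bool" where
  "dim_at_least_two _ \<longleftrightarrow> (\<exists>B :: 'a set. independent B \<and> card B = 2)"

definition uniformly_convex :: "'a::real_normed_vector itself \<Rightarrow> bool" where
  "uniformly_convex _ \<longleftrightarrow>
    (\<forall>\<epsilon>>0. \<exists>\<delta>::real. 0 < \<delta> \<and> \<delta> < 1 \<and>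
      (\<forall>y1 y2 :: 'a. y1 \<in> sphere 0 1 \<longrightarrow> y2 \<in> sphere 0 1 \<longrightarrow>
        norm (y1 + y2) / 2 > 1 - \<delta> \<longrightarrow> norm (y1 - y2) < \<epsilon>))"

definition RSE :: "('z::real_normed_vector \<Rightarrow>\<^sub>L 'y::real_normed_vector) set" where
  "RSE = {T. \<exists>x0 \<in> sphere 0 1. \<forall>x :: nat \<Rightarrow> 'z.
      range x \<subseteq> cball 0 1 \<longrightarrow> (\<lambda>n. norm (blinfun_apply T (x n))) \<longlonglongrightarrow> norm T \<longrightarrow>
      (\<exists>(\<sigma> :: nat \<Rightarrow> nat) (\<theta>::real). strict_mono \<sigma> \<and> \<theta> \<in> {1, -1} \<and>
        (\<lambda>n. blinfun_apply T (x (\<sigma> n))) \<longlonglongrightarrow> \<theta> *\<^sub>R blinfun_apply T x0)}"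

definition BPBp_RSE ::
    "'z::real_normed_vector itself \<Rightarrow> 'y::real_normed_vector itself \<Rightarrow> bool" where
  "BPBp_RSE _ _ \<longleftrightarrow>
    (\<forall>\<epsilon>>0. \<exists>\<eta>::real. 0 < \<eta> \<and> \<eta> < \<epsilon> \<and>
      (\<forall>(T :: 'z \<Rightarrow>\<^sub>L 'y) x. norm T = 1 \<longrightarrow> x \<in> sphere 0 1 \<longrightarrow>
        norm (blinfun_apply T x) > 1 - \<eta> \<longrightarrow>
        (\<exists>S \<in> RSE. \<exists>x0 \<in> sphere 0 1.
          norm S = 1 \<and> norm (blinfun_apply S x0) = 1 \<and> norm (S - T) < \<epsilon> \<and> norm (x - x0) < \<epsilon>)))"

end

theory Submission
  imports Defs
begin

text \<open>
  Both \<open>c\<^sub>0(X)\<close> and \<open>\<ell>\<^sub>\<infinity>\<^sup>m(X)\<close> are treated through their coordinates: the locale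
  \<open>sup_coordinates\<close> asks for a supremum norm, restriction to any set of coordinates,
  vectors with one prescribed coordinate, and only finitely many coordinates above any positive
  level.

  Necessity. Let \<open>y\<^sub>1, y\<^sub>2\<close> be unit vectors whose midpoint \<open>u\<close> is nearly of norm one, and let
  \<open>w = (y\<^sub>1 - y\<^sub>2) / 2\<close>. With a functional \<open>g\<close> norming a unit vector \<open>e\<close>, the operator
  \<open>z \<mapsto> g(z\<^sub>i) u + g(z\<^sub>j) w\<close> has norm one and almost attains it at the vector \<open>x\<close> with \<open>e\<close> in
  coordinate \<open>i\<close>. If \<open>S\<close> is near it and attains its norm at \<open>x\<^sub>0\<close> near \<open>x\<close>, then coordinate \<open>j\<close> of
  \<open>x\<^sub>0\<close> is small, so \<open>x\<^sub>0\<close> is the midpoint of a segment of the ball in direction \<open>j\<close>, and the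
  images under \<open>S\<close> of its points all have norm one. If \<open>S\<close> is range strongly exposing, the images of
  the vectors where it attains its norm are \<open>q\<close> or \<open>-q\<close> for a single \<open>q\<close>; so \<open>S\<close> is constant on the
  segment and kills its direction, which forces \<open>w\<close> to be small (\<open>uniformly_convex_if_BPBp_RSE\<close>).

  Sufficiency. Let \<open>T\<close> have norm one and nearly attain it at the unit vector \<open>x\<close>. The workhorse is
  that \<open>T\<close> is small on vectors supported where a nearly norming vector of the ball stays away from
  norm one: such a vector can be moved both ways along them inside the ball, and uniform convexity of
  \<open>Y\<close> says that its image hardly moves (\<open>operator_small_off_support\<close>). The construction has four
  parts.

  \<^item> Keeping only the coordinates with \<open>\<parallel>x\<^sub>i\<parallel> \<ge> 1/2\<close> changes \<open>T\<close> little, so \<open>T\<close> may be taken to depend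
    on finitely many coordinates.

  \<^item> Composing with \<open>I + \<epsilon> f \<otimes> y\<close> on \<open>Y\<close>, where \<open>f\<close> norms \<open>y = Tx / \<parallel>Tx\<parallel>\<close>, forces the images under
    \<open>T\<close> of vectors nearly norming the composition to be close to \<open>Tx\<close> or \<open>-Tx\<close>
    (\<open>exists_localising_perturbation\<close>). Hence the operators \<open>R\<close> on \<open>Y\<close> for which the images of
    nearly norming vectors of \<open>R \<circ> T\<close> agree up to sign and an error \<open>\<epsilon>\<close> form an open dense set, and
    Baire's theorem yields an \<open>R\<close>, near any prescribed one, that works for every \<open>\<epsilon>\<close>
    (\<open>exists_all_slices_small_perturbation\<close>).

  \<^item> The resulting \<open>S\<close> attains its norm. The images of a maximising sequence converge, up to signs, to
    some \<open>y\<close>; compose \<open>S\<close> with a functional norming \<open>y\<close>. The composition depends on finitely many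
    coordinates and is maximised coordinate by coordinate, since functionals on a uniformly convex
    Banach space attain their norm (\<open>operator_attains_norm\<close>).

  \<^item> So \<open>S\<close> attains its norm at some \<open>z\<close> with \<open>Sz\<close> near \<open>Sx\<close>, but some coordinates of \<open>z\<close> may be far
    from those of \<open>x\<close>. On the set \<open>B\<close> of these coordinates \<open>(z + x) / 2\<close> stays away from norm one, by
    uniform convexity of \<open>X\<close>, so \<open>S\<close> is small on vectors supported in \<open>B\<close>. Let \<open>x\<^sub>0\<close> agree with \<open>x\<close> on
    \<open>B\<close> and with \<open>z\<close> elsewhere. Precomposing \<open>S\<close> with a contraction that maps \<open>x\<^sub>0\<close> to \<open>z\<close> and is the
    identity off \<open>B\<close> changes \<open>S\<close> little and moves the norm attainment to \<open>x\<^sub>0\<close>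
    (\<open>relocate_norm_attainment\<close>). None of the error bounds depends on the
    number of coordinates kept in the first part, which \<open>\<epsilon>\<close> does not control.
\<close>

section \<open>Norming functionals from minimal sublinear functionals\<close>

definition sublinear :: "('a::real_vector \<Rightarrow> real) \<Rightarrow> bool" where
  "sublinear q \<longleftrightarrow> (\<forall>x y. q (x + y) \<le> q x + q y) \<and> (\<forall>r>0. \<forall>x. q (r *\<^sub>R x) = r * q x)"

lemma sublinear_add: "sublinear q \<Longrightarrow> q (x + y) \<le> q x + q y"
  and sublinear_scale: "sublinear q \<Longrightarrow> r > 0 \<Longrightarrow> q (r *\<^sub>R x) = r * q x"
  by (auto simp: sublinear_def)

lemma sublinear_zero: "sublinear q \<Longrightarrow> q 0 = 0"
  using sublinear_scale[of q 2 0] by simp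

lemma sublinear_scale_nonneg: "sublinear q \<Longrightarrow> r \<ge> 0 \<Longrightarrow> q (r *\<^sub>R x) = r * q x"
  using sublinear_scale[of q r x] sublinear_zero[of q] by (cases "r = 0") auto

text \<open>The largest sublinear functional \<open>r \<le> q\<close> with \<open>r (- z) \<le> - q z\<close>; a minimal sublinear functional
  is left unchanged by this operation, and this is what makes it linear.\<close>
definition lowered :: "('a::real_vector \<Rightarrow> real) \<Rightarrow> 'a \<Rightarrow> 'a \<Rightarrow> real" where
  "lowered q z x = (INF t\<in>{0..}. q (x + t *\<^sub>R z) - t * q z)"

lemma lowered_bound:
  assumes "sublinear q" "t \<ge> 0"
  shows "- q (- x) \<le> q (x + t *\<^sub>R z) - t * q z"
  using sublinear_add[OF assms(1), of "x + t *\<^sub>R z" "- x"] sublinear_scale_nonneg[OF assms, of z]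
  by simp

lemma lowered_le:
  assumes "sublinear q" "t \<ge> 0"
  shows "lowered q z x \<le> q (x + t *\<^sub>R z) - t * q z"
  unfolding lowered_def
  by (rule cINF_lower) (use assms lowered_bound in \<open>auto intro!: bdd_belowI2\<close>)

lemma lowered_greatest:
  assumes "\<And>t. t \<ge> 0 \<Longrightarrow> c \<le> q (x + t *\<^sub>R z) - t * q z"
  shows "c \<le> lowered q z x"
  unfolding lowered_def by (rule cINF_greatest) (use assms in auto)

lemma sublinear_lowered:
  assumes q: "sublinear q"
  shows "sublinear (lowered q z)"
  unfolding sublinear_def
proof (intro conjI allI impI)
  fix x y
  have "lowered q z (x + y) - (q (x + s *\<^sub>R z) - s * q z) \<le> lowered q z y" if s: "s \<ge> 0" for s
  proof (rule lowered_greatest)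
    fix t :: real assume t: "t \<ge> 0"
    have "lowered q z (x + y) \<le> q ((x + y) + (s + t) *\<^sub>R z) - (s + t) * q z"
      using lowered_le[OF q] s t by (metis add_nonneg_nonneg)
    also have "(x + y) + (s + t) *\<^sub>R z = (x + s *\<^sub>R z) + (y + t *\<^sub>R z)"
      by (simp add: algebra_simps)
    finally show "lowered q z (x + y) - (q (x + s *\<^sub>R z) - s * q z) \<le> q (y + t *\<^sub>R z) - t * q z"
      using sublinear_add[OF q, of "x + s *\<^sub>R z" "y + t *\<^sub>R z"] by (simp add: algebra_simps)
  qed
  then have "lowered q z (x + y) - lowered q z y \<le> lowered q z x"
    by (intro lowered_greatest) (simp add: algebra_simps)
  then show "lowered q z (x + y) \<le> lowered q z x + lowered q z y" by simp
next
  fix r :: real and x assume r: "r > 0"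
  have le: "lowered q z (s *\<^sub>R x) \<le> s * lowered q z x" if s: "s > 0" for s x
  proof -
    have "lowered q z (s *\<^sub>R x) / s \<le> lowered q z x"
    proof (rule lowered_greatest)
      fix t :: real assume t: "t \<ge> 0"
      have "lowered q z (s *\<^sub>R x) \<le> q (s *\<^sub>R x + (s * t) *\<^sub>R z) - (s * t) * q z"
        using lowered_le[OF q, of "s * t"] s t by simp
      also have "s *\<^sub>R x + (s * t) *\<^sub>R z = s *\<^sub>R (x + t *\<^sub>R z)" by (simp add: algebra_simps)
      finally show "lowered q z (s *\<^sub>R x) / s \<le> q (x + t *\<^sub>R z) - t * q z"
        unfolding sublinear_scale[OF q s] using s by (simp add: field_simps)
    qed
    then show ?thesis using s by (simp add: field_simps)
  qed
  show "lowered q z (r *\<^sub>R x) = r * lowered q z x"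
    using le[OF r, of x] le[of "inverse r" "r *\<^sub>R x"] r by (simp add: field_simps)
qed

text \<open>Zorn's lemma applies because the pointwise infimum of a chain below \<open>p\<close> is again sublinear: it is
  finite since every member \<open>q\<close> satisfies \<open>q x \<ge> - q (- x) \<ge> - p (- x)\<close>.\<close>
lemma minimal_sublinear_below:
  fixes p :: "'a::real_vector \<Rightarrow> real"
  assumes p: "sublinear p"
  shows "\<exists>q. sublinear q \<and> q \<le> p \<and> (\<forall>r. sublinear r \<longrightarrow> r \<le> q \<longrightarrow> r = q)"
proof -
  define A where "A = {q. sublinear q \<and> q \<le> p}"
  define P where "P = (\<lambda>q r :: 'a \<Rightarrow> real. r \<le> q)"
  have "\<exists>m\<in>A. \<forall>a\<in>A. P m a \<longrightarrow> a = m"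
  proof (rule predicate_Zorn)
    show "partial_order_on A (relation_of P A)"
      by (rule partial_order_on_relation_ofI) (auto simp: P_def)
  next
    fix C assume C: "C \<in> Chains (relation_of P A)"
    then have CA: "C \<subseteq> A" by (rule Chains_relation_of)
    have tot: "q \<le> r \<or> r \<le> q" if "q \<in> C" "r \<in> C" for q r
      using C that by (auto simp: Chains_def relation_of_def P_def)
    show "\<exists>u\<in>A. \<forall>a\<in>C. P a u"
    proof (cases "C = {}")
      case True then show ?thesis using p by (auto simp: A_def)
    next
      case False
      define u where "u x = (INF q\<in>C. q x)" for x
      have low: "- p (- x) \<le> q x" if "q \<in> C" for q x
      proof -
        have "sublinear q" "q (- x) \<le> p (- x)" using that CA by (auto simp: A_def le_fun_def)
        then show ?thesis using sublinear_add[of q x "- x"] sublinear_zero[of q] by simp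
      qed
      have u_le: "u x \<le> q x" if "q \<in> C" for q x
        unfolding u_def by (rule cINF_lower) (use that low in \<open>auto intro!: bdd_belowI2\<close>)
      have u_ge: "c \<le> u x" if "\<And>q. q \<in> C \<Longrightarrow> c \<le> q x" for c x
        unfolding u_def by (rule cINF_greatest[OF False]) (use that in auto)
      have sub: "sublinear q" if "q \<in> C" for q using that CA by (auto simp: A_def)
      have "sublinear u"
        unfolding sublinear_def
      proof (intro conjI allI impI)
        fix x y
        \<comment> \<open>Two members of the chain can be replaced by the smaller one, for which subadditivity is known.\<close>
        have *: "u (x + y) \<le> q x + r y" if q: "q \<in> C" and r: "r \<in> C" for q r
        proof -
          obtain s where s: "s \<in> C" "s \<le> q" "s \<le> r" using tot[OF q r] q r by blast
          have "u (x + y) \<le> s x + s y"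
            using u_le[OF s(1)] sublinear_add[OF sub[OF s(1)]] by (meson order_trans)
          also have "\<dots> \<le> q x + r y" using s(2,3) by (simp add: le_fun_def add_mono)
          finally show ?thesis .
        qed
        have "u (x + y) - q x \<le> u y" if "q \<in> C" for q
          by (rule u_ge) (use *[OF that] in \<open>simp add: algebra_simps\<close>)
        then have "u (x + y) - u y \<le> u x"
          by (intro u_ge) (simp add: algebra_simps)
        then show "u (x + y) \<le> u x + u y" by simp
      next
        fix r :: real and x assume r: "r > 0"
        have le: "u (s *\<^sub>R x) \<le> s * u x" if s: "s > 0" for s x
        proof -
          have "u (s *\<^sub>R x) / s \<le> u x"
          proof (rule u_ge)
            fix q assume "q \<in> C"
            then show "u (s *\<^sub>R x) / s \<le> q x"
              using u_le[of q "s *\<^sub>R x"] sublinear_scale[OF sub s, of q x] s by (simp add: field_simps)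
          qed
          then show ?thesis using s by (simp add: field_simps)
        qed
        show "u (r *\<^sub>R x) = r * u x"
          using le[OF r, of x] le[of "inverse r" "r *\<^sub>R x"] r by (simp add: field_simps)
      qed
      moreover have "u \<le> p"
      proof (rule le_funI)
        fix x
        obtain q where "q \<in> C" "q x \<le> p x"
          using False CA by (force simp: A_def le_fun_def)
        then show "u x \<le> p x" using u_le[of q x] by linarith
      qed
      ultimately show ?thesis using u_le by (auto simp: A_def P_def le_fun_def)
    qed
  qed
  then obtain m where m: "sublinear m" "m \<le> p" and min: "\<And>a. a \<in> A \<Longrightarrow> a \<le> m \<Longrightarrow> a = m"
    unfolding P_def by (auto simp: A_def)
  have "r = m" if "sublinear r" "r \<le> m" for r
    by (rule min) (use that m(2) order_trans[of r m p] in \<open>simp_all add: A_def\<close>)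
  with m show ?thesis by blast
qed

text \<open>Minimality below \<open>norm\<close> makes a sublinear functional linear. Starting instead from the norm lowered
  along \<open>y\<close> gives, in addition, \<open>q (- y) \<le> - \<parallel>y\<parallel>\<close>, so that \<open>q\<close> norms \<open>y\<close>.\<close>
lemma exists_norming_functional:
  fixes y :: "'a::real_normed_vector"
  shows "\<exists>f :: 'a \<Rightarrow>\<^sub>L real. norm f \<le> 1 \<and> blinfun_apply f y = norm y"
proof -
  have norm: "sublinear (norm :: 'a \<Rightarrow> real)"
    by (simp add: sublinear_def norm_triangle_ineq)
  obtain q where q: "sublinear q" and qle: "q \<le> lowered norm y"
    and min: "\<And>r. sublinear r \<Longrightarrow> r \<le> q \<Longrightarrow> r = q"
    using minimal_sublinear_below[OF sublinear_lowered[OF norm, of y]] by blast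
  have q_le: "q x \<le> norm x" for x
    using qle lowered_le[OF norm order_refl, of y x] by (auto simp: le_fun_def intro: order_trans)
  have qy: "q (- y) \<le> - norm y"
    using qle lowered_le[OF norm, of 1 y "- y"] by (auto simp: le_fun_def intro: order_trans)
  have add: "q (x + z) = q x + q z" for x z
  proof -
    have "lowered q z \<le> q"
      using lowered_le[OF q order_refl, of z] by (simp add: le_fun_def)
    then have "lowered q z = q" by (rule min[OF sublinear_lowered[OF q]])
    then have "q x \<le> q (x + z) - q z" using lowered_le[OF q, of 1 z x] by simp
    then show ?thesis using sublinear_add[OF q, of x z] by simp
  qed
  have neg: "q (- x) = - q x" for x
    using add[of x "- x"] sublinear_zero[OF q] by simp
  have scale: "q (r *\<^sub>R x) = r *\<^sub>R q x" for r x
  proof (cases "r \<ge> 0")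
    case True then show ?thesis using sublinear_scale_nonneg[OF q] by simp
  next
    case False
    then show ?thesis using sublinear_scale_nonneg[OF q, of "- r" x] neg[of "r *\<^sub>R x"] by simp
  qed
  have bound: "norm (q x) \<le> norm x * 1" for x
    using q_le[of x] q_le[of "- x"] neg[of x] by (simp add: abs_le_iff)
  have bl: "bounded_linear q"
    using add scale bound by (rule bounded_linear_intro)
  have "norm (Blinfun q) \<le> 1"
    by (rule norm_blinfun_bound) (use bound in \<open>simp_all add: bounded_linear_Blinfun_apply[OF bl] mult.commute\<close>)
  moreover have "Blinfun q y = norm y"
    using qy q_le[of y] neg[of y] by (simp add: bounded_linear_Blinfun_apply[OF bl])
  ultimately show ?thesis by blast
qed

section \<open>Uniform convexity\<close>

lemma norm_blinfun_le_on_ball: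
  assumes "norm z \<le> 1" shows "norm (blinfun_apply S z) \<le> norm S"
  using order_trans[OF norm_blinfun[of S z] mult_left_mono[OF assms norm_ge_zero]] by simp

lemma norm_blinfun_le_if_ball:
  fixes S :: "'z::real_normed_vector \<Rightarrow>\<^sub>L 'y::real_normed_vector"
  assumes "\<And>z. norm z \<le> 1 \<Longrightarrow> norm (blinfun_apply S z) \<le> K"
  shows "norm S \<le> K"
proof (rule norm_blinfun_bound)
  show K: "0 \<le> K" using assms[of 0] by simp
  fix x show "norm (blinfun_apply S x) \<le> K * norm x"
  proof (cases "x = 0")
    case False
    then have "norm (blinfun_apply S ((1 / norm x) *\<^sub>R x)) \<le> K" by (intro assms) simp
    then show ?thesis using False by (simp add: blinfun.scaleR_right field_simps)
  qed simp
qed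

lemma exists_near_norm:
  fixes S :: "'z::real_normed_vector \<Rightarrow>\<^sub>L 'y::real_normed_vector"
  assumes "\<theta> > 0"
  shows "\<exists>z. norm z \<le> 1 \<and> norm (blinfun_apply S z) > norm S - \<theta>"
proof (rule ccontr)
  assume "\<not> ?thesis"
  then have "norm S \<le> norm S - \<theta>"
    by (intro norm_blinfun_le_if_ball) (meson not_le)
  with assms show False by simp
qed

text \<open>Uniform convexity for the ball rather than the sphere: vectors of the ball whose sum is nearly of
  norm two are themselves nearly of norm one, so normalising them costs little.\<close>
lemma uniformly_convex_ball:
  assumes uc: "uniformly_convex TYPE('a::real_normed_vector)" and e: "e > (0::real)"
  shows "\<exists>d>0. \<forall>a b :: 'a. norm a \<le> 1 \<longrightarrow> norm b \<le> 1 \<longrightarrow> norm (a + b) > 2 - d \<longrightarrow> norm (a - b) < e"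
proof -
  obtain d where d: "0 < d" "d < 1" and D: "\<And>y1 y2 :: 'a. norm y1 = 1 \<Longrightarrow> norm y2 = 1 \<Longrightarrow>
      norm (y1 + y2) / 2 > 1 - d \<Longrightarrow> norm (y1 - y2) < e / 2"
    using uc e unfolding uniformly_convex_def by (auto dest!: spec[of _ "e/2"])
  define d' where "d' = min (d / 2) (min (e / 4) (1 / 2))"
  have d': "d' > 0" "d' \<le> d / 2" "d' \<le> e / 4" "d' \<le> 1 / 2" using d e by (auto simp: d'_def)
  have "norm (a - b) < e" if a: "norm a \<le> 1" and b: "norm b \<le> 1" and ab: "norm (a + b) > 2 - d'" for a b :: 'a
  proof -
    have na: "norm a > 1 - d'" and nb: "norm b > 1 - d'"
      using norm_triangle_ineq[of a b] a b ab by linarith+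
    have pos: "norm a > 0" "norm b > 0" using na nb d' by linarith+
    have dist: "norm (sgn c - c) < d'" if "norm c \<le> 1" "norm c > 1 - d'" "norm c > 0" for c :: 'a
    proof -
      have "sgn c - c = (1 / norm c - 1) *\<^sub>R c" by (simp add: sgn_div_norm algebra_simps divide_inverse)
      then have "norm (sgn c - c) = \<bar>1 / norm c - 1\<bar> * norm c" by simp
      also have "\<dots> = 1 - norm c" using that by (simp add: abs_if field_simps)
      finally show ?thesis using that by simp
    qed
    note da = dist[OF a na pos(1)] and db = dist[OF b nb pos(2)]
    have eq: "a + b = (sgn a + sgn b) - ((sgn a - a) + (sgn b - b))" by simp
    have "norm (a + b) \<le> norm (sgn a + sgn b) + norm ((sgn a - a) + (sgn b - b))"
      by (subst eq) (rule norm_triangle_ineq4)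
    also have "\<dots> \<le> norm (sgn a + sgn b) + (norm (sgn a - a) + norm (sgn b - b))"
      using norm_triangle_ineq by simp
    finally have "norm (sgn a + sgn b) > 2 - 3 * d'" using ab da db by linarith
    then have "norm (sgn a + sgn b) / 2 > 1 - d" using d' d by (simp add: field_simps)
    then have sg: "norm (sgn a - sgn b) < e / 2"
      using pos by (intro D) (auto simp: norm_sgn)
    have eq': "a - b = (sgn a - sgn b) - ((sgn a - a) - (sgn b - b))" by simp
    have "norm (a - b) \<le> norm (sgn a - sgn b) + norm ((sgn a - a) - (sgn b - b))"
      by (subst eq') (rule norm_triangle_ineq4)
    then have "norm (a - b) \<le> norm (sgn a - sgn b) + (norm (sgn a - a) + norm (sgn b - b))"
      using norm_triangle_ineq4[of "sgn a - a" "sgn b - b"] by linarith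
    then show ?thesis using sg da db d' by linarith
  qed
  then show ?thesis using d' by blast
qed

text \<open>The form in which uniform convexity is used for operators: a segment of the ball whose midpoint is
  nearly of norm one is short.\<close>
lemma uniformly_convex_direction:
  assumes uc: "uniformly_convex TYPE('a::real_normed_vector)" and e: "e > (0::real)"
  shows "\<exists>d>0. \<forall>c v :: 'a. norm (c + v) \<le> 1 \<longrightarrow> norm (c - v) \<le> 1 \<longrightarrow> norm c > 1 - d \<longrightarrow> norm v < e"
proof -
  obtain d where d: "d > 0" and D: "\<And>a b :: 'a. norm a \<le> 1 \<Longrightarrow> norm b \<le> 1 \<Longrightarrow>
      norm (a + b) > 2 - d \<Longrightarrow> norm (a - b) < 2 * e"
    using uniformly_convex_ball[OF uc, of "2 * e"] e by auto
  have "norm v < e" if "norm (c + v) \<le> 1" "norm (c - v) \<le> 1" "norm c > 1 - d / 2" for c v :: 'a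
  proof -
    have s: "(c + v) + (c - v) = 2 *\<^sub>R c" "(c + v) - (c - v) = 2 *\<^sub>R v" by (simp_all add: scaleR_2)
    show ?thesis using D[OF that(1,2)] that(3) unfolding s by simp
  qed
  then show ?thesis using d by (intro exI[of _ "d / 2"]) auto
qed

text \<open>A maximising sequence is Cauchy, because the midpoints of its late members are nearly of norm one.\<close>
lemma uniformly_convex_attains_norm:
  fixes f :: "'x::banach \<Rightarrow>\<^sub>L real"
  assumes uc: "uniformly_convex TYPE('x)"
  shows "\<exists>v. norm v \<le> 1 \<and> blinfun_apply f v = norm f"
proof (cases "f = 0")
  case True then show ?thesis by (intro exI[of _ 0]) simp
next
  case False
  then have nf: "norm f > 0" by simp
  have "\<exists>z. norm z \<le> 1 \<and> blinfun_apply f z > norm f - 1 / real (Suc n)" for n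
  proof -
    obtain z where z: "norm z \<le> 1" "norm (blinfun_apply f z) > norm f - 1 / real (Suc n)"
      using exists_near_norm[of "1 / real (Suc n)" f] by auto
    show ?thesis
    proof (cases "blinfun_apply f z \<ge> 0")
      case True with z show ?thesis by auto
    next
      case False with z show ?thesis by (intro exI[of _ "- z"]) (auto simp: blinfun.minus_right)
    qed
  qed
  then obtain z where z: "\<And>n. norm (z n) \<le> 1" and fz: "\<And>n. blinfun_apply f (z n) > norm f - 1 / real (Suc n)"
    by metis
  have "Cauchy z"
    unfolding Cauchy_def dist_norm
  proof (intro allI impI)
    fix e :: real assume "e > 0"
    then obtain d where d: "d > 0" and D: "\<And>a b :: 'x. norm a \<le> 1 \<Longrightarrow> norm b \<le> 1 \<Longrightarrow>
      norm (a + b) > 2 - d \<Longrightarrow> norm (a - b) < e"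
      using uniformly_convex_ball[OF uc] by metis
    have "d * norm f / 2 > 0" using d nf by simp
    then obtain N where N: "1 / real (Suc N) < d * norm f / 2"
      using nat_approx_posE by blast
    have fN: "blinfun_apply f (z n) > norm f - d * norm f / 2" if "n \<ge> N" for n
    proof -
      have "1 / real (Suc n) \<le> 1 / real (Suc N)" using that by (simp add: field_simps)
      then show ?thesis using N fz[of n] by linarith
    qed
    have "norm (z m - z n) < e" if "m \<ge> N" "n \<ge> N" for m n
    proof (rule D[OF z z])
      have "norm f * (2 - d) < blinfun_apply f (z m) + blinfun_apply f (z n)"
        using fN[OF that(1)] fN[OF that(2)] by (simp add: algebra_simps)
      also have "\<dots> = blinfun_apply f (z m + z n)" by (simp add: blinfun.add_right)
      also have "\<dots> \<le> norm f * norm (z m + z n)" using norm_blinfun[of f "z m + z n"] by simp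
      finally show "norm (z m + z n) > 2 - d" using nf by simp
    qed
    then show "\<exists>M. \<forall>m\<ge>M. \<forall>n\<ge>M. norm (z m - z n) < e" by blast
  qed
  then obtain v where v: "z \<longlonglongrightarrow> v" using Cauchy_convergent_iff convergent_def by blast
  have nv: "norm v \<le> 1"
    by (rule LIMSEQ_le_const2[OF tendsto_norm[OF v]]) (use z in auto)
  have "(\<lambda>n. blinfun_apply f (z n)) \<longlonglongrightarrow> blinfun_apply f v"
    by (intro tendsto_intros v)
  moreover have "(\<lambda>n. norm f - 1 / real (Suc n)) \<longlonglongrightarrow> norm f - 0"
    by (intro tendsto_intros LIMSEQ_inverse_real_of_nat[unfolded inverse_eq_divide])
  ultimately have "norm f \<le> blinfun_apply f v"
    using fz by (intro LIMSEQ_le[of "\<lambda>n. norm f - 1 / real (Suc n)"]) (auto intro: less_imp_le)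
  moreover have "blinfun_apply f v \<le> norm f" using norm_blinfun_le_on_ball[OF nv, of f] by simp
  ultimately show ?thesis using nv by (intro exI[of _ v]) simp
qed

section \<open>Operators with small range slices\<close>

text \<open>Nearly norming vectors of \<open>S\<close> have images that agree up to sign and an error \<open>\<epsilon>\<close>. Having this for
  all \<open>\<epsilon>\<close>, together with norm attainment, is a quantitative form of being range strongly exposing. Two
  images are compared with each other, rather than with a centre of the slice, so that slices for
  different \<open>\<epsilon>\<close> have no centres that would have to be related.\<close>
definition range_slices_small :: "('z::real_normed_vector \<Rightarrow>\<^sub>L 'y::real_normed_vector) \<Rightarrow> real \<Rightarrow> bool" where
  "range_slices_small S \<epsilon> \<longleftrightarrow> (\<exists>\<theta>>0. \<forall>z z'. norm z \<le> 1 \<longrightarrow> norm z' \<le> 1 \<longrightarrow>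
     norm (blinfun_apply S z) > norm S - \<theta> \<longrightarrow> norm (blinfun_apply S z') > norm S - \<theta> \<longrightarrow>
     norm (blinfun_apply S z - blinfun_apply S z') < \<epsilon> \<or>
     norm (blinfun_apply S z + blinfun_apply S z') < \<epsilon>)"

lemma range_slices_smallD:
  assumes "range_slices_small S \<epsilon>"
  obtains \<theta> where "\<theta> > 0" "\<And>z z'. norm z \<le> 1 \<Longrightarrow> norm z' \<le> 1 \<Longrightarrow>
     norm (blinfun_apply S z) > norm S - \<theta> \<Longrightarrow> norm (blinfun_apply S z') > norm S - \<theta> \<Longrightarrow>
     norm (blinfun_apply S z - blinfun_apply S z') < \<epsilon> \<or>
     norm (blinfun_apply S z + blinfun_apply S z') < \<epsilon>"
  using assms unfolding range_slices_small_def by metis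

text \<open>A rank-one perturbation of the identity; when \<open>f(y) = 1\<close>, it stretches the direction \<open>y\<close> by
  the factor \<open>1 + e\<close>.\<close>
definition bump :: "real \<Rightarrow> ('y::real_normed_vector \<Rightarrow>\<^sub>L real) \<Rightarrow> 'y \<Rightarrow> 'y \<Rightarrow>\<^sub>L 'y" where
  "bump e f y = id_blinfun + e *\<^sub>R (blinfun_scaleR_left y o\<^sub>L f)"

lemma bump_apply: "blinfun_apply (bump e f y) w = w + (e * blinfun_apply f w) *\<^sub>R y"
  by (simp add: bump_def blinfun.add_left blinfun.scaleR_left)

lemma norm_bump_le:
  assumes "e \<ge> 0" "norm f \<le> 1" "norm y \<le> 1"
  shows "norm (bump e f y - id_blinfun) \<le> e"
proof (rule norm_blinfun_bound[OF assms(1)])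
  fix w
  have "\<bar>blinfun_apply f w\<bar> \<le> norm w"
    using norm_blinfun[of f w] mult_right_mono[OF assms(2) norm_ge_zero[of w]] by simp
  then have "\<bar>blinfun_apply f w\<bar> * norm y \<le> norm w * 1"
    using assms(3) by (intro mult_mono) auto
  then show "norm (blinfun_apply (bump e f y - id_blinfun) w) \<le> e * norm w"
    using assms(1) by (simp add: blinfun.diff_left bump_apply abs_mult mult.assoc mult_left_mono)
qed

text \<open>If \<open>f\<close> norms \<open>Tx\<close>, adding \<open>e f(T\<cdot>) y\<close> with \<open>y = Tx / \<parallel>Tx\<parallel>\<close> raises the norm at \<open>x\<close> by about \<open>e\<close>,
  the largest gain possible; so a vector \<open>z\<close> nearly norming the new operator has \<open>\<bar>f(Tz)\<bar>\<close> near one. Then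
  \<open>Tx + Tz\<close> or \<open>Tx - Tz\<close> is nearly of norm two, and uniform convexity applies.\<close>
lemma exists_localising_perturbation:
  assumes uc: "uniformly_convex TYPE('y::real_normed_vector)" and e: "e > (0::real)"
  shows "\<exists>\<eta>>0. \<forall>(T :: 'z::real_normed_vector \<Rightarrow>\<^sub>L 'y) x. norm T \<le> 1 \<longrightarrow> norm x \<le> 1 \<longrightarrow>
     norm (blinfun_apply T x) > 1 - \<eta> \<longrightarrow>
     (\<exists>R :: 'y \<Rightarrow>\<^sub>L 'y. norm (R - id_blinfun) \<le> e \<and>
        (\<exists>\<theta>>0. \<forall>z. norm z \<le> 1 \<longrightarrow> norm (blinfun_apply R (blinfun_apply T z)) > norm (R o\<^sub>L T) - \<theta> \<longrightarrow>
            norm (blinfun_apply T z - blinfun_apply T x) < e \<or> norm (blinfun_apply T z + blinfun_apply T x) < e))"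
proof -
  obtain d where d: "d > 0" and D: "\<And>a b :: 'y. norm a \<le> 1 \<Longrightarrow> norm b \<le> 1 \<Longrightarrow>
      norm (a + b) > 2 - d \<Longrightarrow> norm (a - b) < e"
    using uniformly_convex_ball[OF uc e] by metis
  \<comment> \<open>The loss in \<open>\<bar>f(Tz)\<bar>\<close> is \<open>\<eta> + 2 \<eta> / e\<close>, and that in \<open>f(Tx)\<close> is \<open>\<eta>\<close>; they have to add up to at
    most \<open>d\<close>.\<close>
  define \<eta> where "\<eta> = min (d / 2 / (1 + 1 / e)) 1"
  have \<eta>: "\<eta> > 0" "\<eta> \<le> 1" using d e by (auto simp: \<eta>_def add_pos_pos)
  have "\<eta> \<le> d / 2 / (1 + 1 / e)" by (simp add: \<eta>_def)
  then have "\<eta> * (1 + 1 / e) \<le> d / 2"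
    by (subst (asm) pos_le_divide_eq) (use e in \<open>auto intro: add_pos_pos\<close>)
  then have \<eta>d: "2 * \<eta> + 2 * \<eta> / e \<le> d" using e by (simp add: field_simps)
  have "\<exists>R :: 'y \<Rightarrow>\<^sub>L 'y. norm (R - id_blinfun) \<le> e \<and>
        (\<exists>\<theta>>0. \<forall>z. norm z \<le> 1 \<longrightarrow> norm (blinfun_apply R (blinfun_apply T z)) > norm (R o\<^sub>L T) - \<theta> \<longrightarrow>
            norm (blinfun_apply T z - blinfun_apply T x) < e \<or> norm (blinfun_apply T z + blinfun_apply T x) < e)"
    if T: "norm T \<le> 1" and x: "norm x \<le> 1" and Tx: "norm (blinfun_apply T x) > 1 - \<eta>"
    for T :: "'z \<Rightarrow>\<^sub>L 'y" and x
  proof -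
    let ?T = "blinfun_apply T"
    have ball: "norm (?T z) \<le> 1" if "norm z \<le> 1" for z
      using norm_blinfun_le_on_ball[OF that, of T] T by simp
    have pos: "norm (?T x) > 0" using Tx \<eta> by linarith
    obtain f :: "'y \<Rightarrow>\<^sub>L real" where f: "norm f \<le> 1" "blinfun_apply f (?T x) = norm (?T x)"
      using exists_norming_functional by blast
    have f_le: "\<bar>blinfun_apply f w\<bar> \<le> norm w" for w
      using norm_blinfun[of f w] mult_right_mono[OF f(1) norm_ge_zero[of w]] by simp
    define R where "R = bump e f (sgn (?T x))"
    have R: "norm (R - id_blinfun) \<le> e"
      unfolding R_def using e f by (intro norm_bump_le) (auto simp: norm_sgn)
    have "?T x + (e * norm (?T x)) *\<^sub>R sgn (?T x) = (1 + e) *\<^sub>R ?T x"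
      using pos by (simp add: sgn_div_norm algebra_simps)
    then have "blinfun_apply R (?T x) = (1 + e) *\<^sub>R ?T x"
      by (simp add: R_def bump_apply f)
    then have big: "norm (R o\<^sub>L T) \<ge> (1 + e) * norm (?T x)"
      using norm_blinfun_le_on_ball[OF x, of "R o\<^sub>L T"] e by simp
    have "norm (?T z - ?T x) < e \<or> norm (?T z + ?T x) < e"
      if z: "norm z \<le> 1" and near: "norm (blinfun_apply R (?T z)) > norm (R o\<^sub>L T) - \<eta>" for z
    proof -
      have "norm (blinfun_apply R (?T z)) \<le> norm (?T z) + e * \<bar>blinfun_apply f (?T z)\<bar>"
        unfolding R_def bump_apply
        by (rule order_trans[OF norm_triangle_ineq]) (use e pos in \<open>simp add: norm_sgn abs_mult\<close>)
      then have "e * \<bar>blinfun_apply f (?T z)\<bar> > (1 + e) * (1 - \<eta>) - \<eta> - 1"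
        using near big ball[OF z] mult_strict_left_mono[OF Tx, of "1 + e"] e by linarith
      then have "e * (1 - \<eta> - 2 * \<eta> / e) < e * \<bar>blinfun_apply f (?T z)\<bar>"
        using e by (simp add: algebra_simps)
      then have large: "\<bar>blinfun_apply f (?T z)\<bar> > 1 - \<eta> - 2 * \<eta> / e"
        using e by simp
      show ?thesis
      proof (cases "blinfun_apply f (?T z) \<ge> 0")
        case True
        have "2 - d < blinfun_apply f (?T z + ?T x)"
          using True large Tx \<eta>d by (simp add: blinfun.add_right f)
        also have "\<dots> \<le> norm (?T z + ?T x)" using f_le[of "?T z + ?T x"] by simp
        finally show ?thesis using D[OF ball[OF z] ball[OF x]] by blast
      next
        case False
        have "2 - d < blinfun_apply f (- ?T z + ?T x)"
          using False large Tx \<eta>d by (simp add: blinfun.diff_right f)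
        also have "\<dots> \<le> norm (- ?T z + ?T x)" using f_le[of "- ?T z + ?T x"] by simp
        finally have "norm (- ?T z - ?T x) < e"
          by (intro D) (use ball z x in auto)
        then show ?thesis using norm_minus_cancel[of "?T z + ?T x"] by simp
      qed
    qed
    then show ?thesis using R \<eta>(1) by blast
  qed
  then show ?thesis using \<eta>(1) by blast
qed

text \<open>The density step for Baire's theorem: after normalising \<open>T\<close>, the images of all nearly norming vectors
  are close to one point up to sign, hence close to each other up to sign.\<close>
lemma exists_slices_small_perturbation:
  fixes T :: "'z::real_normed_vector \<Rightarrow>\<^sub>L 'y::real_normed_vector"
  assumes uc: "uniformly_convex TYPE('y)" and e: "e > 0"
  shows "\<exists>R :: 'y \<Rightarrow>\<^sub>L 'y. norm (R - id_blinfun) \<le> e \<and> range_slices_small (R o\<^sub>L T) e"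
proof (cases "T = 0")
  case True
  then show ?thesis
    using e by (intro exI[of _ id_blinfun]) (auto simp: range_slices_small_def intro!: exI[of _ 1])
next
  case False
  define k where "k = norm T"
  have k: "k > 0" using False by (simp add: k_def)
  define T' where "T' = (1 / k) *\<^sub>R T"
  have nT': "norm T' = 1" using k by (simp add: T'_def k_def)
  have T: "blinfun_apply T z = k *\<^sub>R blinfun_apply T' z" for z
    using k by (simp add: T'_def blinfun.scaleR_left)
  define d where "d = min 1 (min e (e / (8 * k)))"
  have d: "d > 0" "d \<le> 1" "d \<le> e" "8 * k * d \<le> e"
    using e k by (auto simp: d_def min_def field_simps)
  obtain \<eta> where \<eta>: "\<eta> > 0" and loc: "\<And>(T :: 'z \<Rightarrow>\<^sub>L 'y) x. norm T \<le> 1 \<Longrightarrow> norm x \<le> 1 \<Longrightarrow>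
     norm (blinfun_apply T x) > 1 - \<eta> \<Longrightarrow>
     (\<exists>R :: 'y \<Rightarrow>\<^sub>L 'y. norm (R - id_blinfun) \<le> d \<and>
        (\<exists>\<theta>>0. \<forall>z. norm z \<le> 1 \<longrightarrow> norm (blinfun_apply R (blinfun_apply T z)) > norm (R o\<^sub>L T) - \<theta> \<longrightarrow>
            norm (blinfun_apply T z - blinfun_apply T x) < d \<or> norm (blinfun_apply T z + blinfun_apply T x) < d))"
    using exists_localising_perturbation[OF uc d(1)] by metis
  obtain x where x: "norm x \<le> 1" "norm (blinfun_apply T' x) > 1 - \<eta>"
    using exists_near_norm[OF \<eta>, of T'] nT' by auto
  obtain R :: "'y \<Rightarrow>\<^sub>L 'y" and \<theta> where R: "norm (R - id_blinfun) \<le> d" and \<theta>: "\<theta> > 0"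
    and near: "\<And>z. norm z \<le> 1 \<Longrightarrow> norm (blinfun_apply R (blinfun_apply T' z)) > norm (R o\<^sub>L T') - \<theta> \<Longrightarrow>
      norm (blinfun_apply T' z - blinfun_apply T' x) < d \<or> norm (blinfun_apply T' z + blinfun_apply T' x) < d"
    using loc[of T' x] x nT' by auto
  have "norm R \<le> norm (R - id_blinfun) + norm (id_blinfun :: 'y \<Rightarrow>\<^sub>L 'y)"
    by (metis norm_triangle_sub add.commute)
  then have nR: "norm R \<le> 2" using R d norm_blinfun_id_le[where 'a='y] by linarith
  have RT: "R o\<^sub>L T = k *\<^sub>R (R o\<^sub>L T')"
    by (rule blinfun_eqI) (simp add: T blinfun.scaleR_right blinfun.scaleR_left)
  have nRT: "norm (R o\<^sub>L T) = k * norm (R o\<^sub>L T')" unfolding RT using k by simp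
  have small: "norm (blinfun_apply R (k *\<^sub>R w)) < e" if "norm w < 2 * d" for w
  proof -
    have "norm (blinfun_apply R (k *\<^sub>R w)) \<le> 2 * (k * norm w)"
      using order_trans[OF norm_blinfun[of R "k *\<^sub>R w"] mult_right_mono[OF nR norm_ge_zero]] k by simp
    also have "\<dots> < 2 * (k * (2 * d))" using that k by simp
    also have "\<dots> \<le> e" using d e by (simp add: algebra_simps)
    finally show ?thesis .
  qed
  have "range_slices_small (R o\<^sub>L T) e"
    unfolding range_slices_small_def
  proof (intro exI[of _ "k * \<theta>"] conjI allI impI)
    show "0 < k * \<theta>" using k \<theta> by simp
    fix z z' :: 'z assume z: "norm z \<le> 1" and z': "norm z' \<le> 1"
    have near': "norm (blinfun_apply T' z - blinfun_apply T' x) < d \<or> norm (blinfun_apply T' z + blinfun_apply T' x) < d"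
      if z: "norm z \<le> 1" and "norm (blinfun_apply (R o\<^sub>L T) z) > norm (R o\<^sub>L T) - k * \<theta>" for z
    proof (rule near[OF z])
      have "k * norm (blinfun_apply R (blinfun_apply T' z)) > k * (norm (R o\<^sub>L T') - \<theta>)"
        using that(2) k by (simp add: nRT T blinfun.scaleR_right algebra_simps)
      then show "norm (blinfun_apply R (blinfun_apply T' z)) > norm (R o\<^sub>L T') - \<theta>"
        using k by simp
    qed
    assume "norm (blinfun_apply (R o\<^sub>L T) z) > norm (R o\<^sub>L T) - k * \<theta>"
      and "norm (blinfun_apply (R o\<^sub>L T) z') > norm (R o\<^sub>L T) - k * \<theta>"
    note near'[OF z this(1)] near'[OF z' this(2)]
    moreover have "norm (a - b) < 2 * d \<or> norm (a + b) < 2 * d"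
      if "norm (a - c) < d \<or> norm (a + c) < d" "norm (b - c) < d \<or> norm (b + c) < d" for a b c :: 'y
    proof -
      have "norm (a - b) \<le> norm (a - c) + norm (b - c)"
        using norm_triangle_ineq4[of "a - c" "b - c"] by simp
      moreover have "norm (a - b) \<le> norm (a + c) + norm (b + c)"
        using norm_triangle_ineq4[of "a + c" "b + c"] by simp
      moreover have "norm (a + b) \<le> norm (a - c) + norm (b + c)"
        using norm_triangle_ineq[of "a - c" "b + c"] by simp
      moreover have "norm (a + b) \<le> norm (a + c) + norm (b - c)"
        using norm_triangle_ineq[of "a + c" "b - c"] by simp
      ultimately show ?thesis using that by linarith
    qed
    ultimately have "norm (blinfun_apply T' z - blinfun_apply T' z') < 2 * d \<or>
        norm (blinfun_apply T' z + blinfun_apply T' z') < 2 * d" by blast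
    then show "norm (blinfun_apply (R o\<^sub>L T) z - blinfun_apply (R o\<^sub>L T) z') < e \<or>
        norm (blinfun_apply (R o\<^sub>L T) z + blinfun_apply (R o\<^sub>L T) z') < e"
      using small[of "blinfun_apply T' z - blinfun_apply T' z'"] small[of "blinfun_apply T' z + blinfun_apply T' z'"]
      by (auto simp: T blinfun.add_right blinfun.diff_right scaleR_add_right scaleR_diff_right)
  qed
  with R d show ?thesis by (intro exI[of _ R]) auto
qed

lemma range_slices_small_stable:
  fixes S :: "'z::real_normed_vector \<Rightarrow>\<^sub>L 'y::real_normed_vector"
  assumes S: "range_slices_small S \<rho>" and "\<rho> < \<epsilon>"
  shows "\<exists>s>0. \<forall>S'. norm (S' - S) < s \<longrightarrow> range_slices_small S' \<epsilon>"
proof -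
  obtain \<theta> where \<theta>: "\<theta> > 0" and D: "\<And>z z'. norm z \<le> 1 \<Longrightarrow> norm z' \<le> 1 \<Longrightarrow>
     norm (blinfun_apply S z) > norm S - \<theta> \<Longrightarrow> norm (blinfun_apply S z') > norm S - \<theta> \<Longrightarrow>
     norm (blinfun_apply S z - blinfun_apply S z') < \<rho> \<or>
     norm (blinfun_apply S z + blinfun_apply S z') < \<rho>"
    using range_slices_smallD[OF S] by metis
  define s where "s = min (\<theta> / 4) ((\<epsilon> - \<rho>) / 2)"
  have s: "s > 0" "4 * s \<le> \<theta>" "2 * s \<le> \<epsilon> - \<rho>" using \<theta> assms(2) by (auto simp: s_def min_def)
  have "range_slices_small S' \<epsilon>" if S': "norm (S' - S) < s" for S'
    unfolding range_slices_small_def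
  proof (intro exI[of _ "\<theta> / 2"] conjI allI impI)
    show "0 < \<theta> / 2" using \<theta> by simp
    have diff: "norm (blinfun_apply S' z - blinfun_apply S z) \<le> s" if "norm z \<le> 1" for z
      using norm_blinfun_le_on_ball[OF that, of "S' - S"] S' by (simp add: blinfun.diff_left)
    have nS: "norm S < norm S' + s"
      using S' norm_triangle_sub[of S S'] by (simp add: norm_minus_commute)
    have near: "norm (blinfun_apply S z) > norm S - \<theta>"
      if "norm z \<le> 1" "norm (blinfun_apply S' z) > norm S' - \<theta> / 2" for z
      using that(2) diff[OF that(1)] nS s norm_triangle_sub[of "blinfun_apply S' z" "blinfun_apply S z"]
      by linarith
    fix z z' :: 'z assume z: "norm z \<le> 1" "norm z' \<le> 1"
      and "norm (blinfun_apply S' z) > norm S' - \<theta> / 2" "norm (blinfun_apply S' z') > norm S' - \<theta> / 2"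
    then have "norm (blinfun_apply S z - blinfun_apply S z') < \<rho> \<or>
       norm (blinfun_apply S z + blinfun_apply S z') < \<rho>"
      using D near by blast
    moreover have "norm (blinfun_apply S' z - blinfun_apply S' z') \<le> norm (blinfun_apply S z - blinfun_apply S z') + (s + s)"
      using norm_triangle_sub[of "blinfun_apply S' z - blinfun_apply S' z'" "blinfun_apply S z - blinfun_apply S z'"]
        norm_triangle_ineq4[of "blinfun_apply S' z - blinfun_apply S z" "blinfun_apply S' z' - blinfun_apply S z'"]
        diff[OF z(1)] diff[OF z(2)]
      by (simp add: algebra_simps)
    moreover have "norm (blinfun_apply S' z + blinfun_apply S' z') \<le> norm (blinfun_apply S z + blinfun_apply S z') + (s + s)"
      using norm_triangle_sub[of "blinfun_apply S' z + blinfun_apply S' z'" "blinfun_apply S z + blinfun_apply S z'"]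
        norm_triangle_ineq[of "blinfun_apply S' z - blinfun_apply S z" "blinfun_apply S' z' - blinfun_apply S z'"]
        diff[OF z(1)] diff[OF z(2)]
      by (simp add: algebra_simps)
    ultimately show "norm (blinfun_apply S' z - blinfun_apply S' z') < \<epsilon> \<or>
       norm (blinfun_apply S' z + blinfun_apply S' z') < \<epsilon>"
      using s by linarith
  qed
  with s show ?thesis by blast
qed

lemma range_slices_small_mono: "range_slices_small S \<rho> \<Longrightarrow> \<rho> \<le> \<epsilon> \<Longrightarrow> range_slices_small S \<epsilon>"
  unfolding range_slices_small_def by (meson order_less_le_trans)

text \<open>Baire's theorem is applied to the operators on \<open>Y\<close> rather than to those from \<open>Z\<close> to \<open>Y\<close>: composition
  on the left preserves the fact that \<open>T\<close> depends on finitely many coordinates only, which is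
  needed for norm attainment.\<close>
lemma exists_all_slices_small_perturbation:
  fixes T :: "'z::real_normed_vector \<Rightarrow>\<^sub>L 'y::banach" and R0 :: "'y \<Rightarrow>\<^sub>L 'y"
  assumes uc: "uniformly_convex TYPE('y)" and e: "e > 0"
  shows "\<exists>R. norm (R - R0) < e \<and> (\<forall>\<epsilon>>0. range_slices_small (R o\<^sub>L T) \<epsilon>)"
proof -
  \<comment> \<open>The strict inequality for \<open>\<rho>\<close> leaves the room that makes \<open>U n\<close> open.\<close>
  define U :: "nat \<Rightarrow> ('y \<Rightarrow>\<^sub>L 'y) set"
    where "U n = {R. \<exists>\<rho><1 / real (Suc n). range_slices_small (R o\<^sub>L T) \<rho>}" for n
  have op: "open (U n)" for n
    unfolding open_dist
  proof (intro ballI)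
    fix R assume "R \<in> U n"
    then obtain \<rho> where \<rho>: "\<rho> < 1 / real (Suc n)" "range_slices_small (R o\<^sub>L T) \<rho>" by (auto simp: U_def)
    obtain \<rho>' where \<rho>': "\<rho> < \<rho>'" "\<rho>' < 1 / real (Suc n)" using dense[OF \<rho>(1)] by blast
    obtain s where s: "s > 0" "\<And>S'. norm (S' - (R o\<^sub>L T)) < s \<Longrightarrow> range_slices_small S' \<rho>'"
      using range_slices_small_stable[OF \<rho>(2) \<rho>'(1)] by blast
    have "R' \<in> U n" if "dist R' R < s / (norm T + 1)" for R'
    proof -
      have "norm ((R' o\<^sub>L T) - (R o\<^sub>L T)) \<le> norm (R' - R) * norm T"
        using norm_blinfun_compose[of "R' - R" T]
        by (simp add: bounded_bilinear.diff_left[OF bounded_bilinear_blinfun_compose])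
      also have "\<dots> \<le> norm (R' - R) * (norm T + 1)" by (intro mult_left_mono) auto
      also have "\<dots> < s"
        using that norm_ge_zero[of T] by (subst (asm) pos_less_divide_eq) (auto simp: dist_norm add_nonneg_pos)
      finally show ?thesis using s(2) \<rho>'(2) by (auto simp: U_def)
    qed
    then show "\<exists>e>0. \<forall>R'. dist R' R < e \<longrightarrow> R' \<in> U n"
      using s(1) norm_ge_zero[of T] by (intro exI[of _ "s / (norm T + 1)"]) (auto simp: add_nonneg_pos)
  qed
  have dense: "closure (U n) = UNIV" for n
  proof -
    have "\<exists>R'\<in>U n. dist R' R < d" if d: "d > 0" for R d
    proof -
      define c where "c = min (d / 2 / (norm R + 1)) (1 / 2 / real (Suc n))"
      have nR: "norm R + 1 > 0" using norm_ge_zero[of R] by linarith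
      have c: "c > 0" "c < 1 / real (Suc n)"
        using d nR by (auto simp: c_def min_less_iff_disj field_simps)
      have "c \<le> d / 2 / (norm R + 1)" by (simp add: c_def)
      then have cd: "c * (norm R + 1) \<le> d / 2" by (subst (asm) pos_le_divide_eq[OF nR])
      obtain R1 :: "'y \<Rightarrow>\<^sub>L 'y" where R1: "norm (R1 - id_blinfun) \<le> c" "range_slices_small (R1 o\<^sub>L (R o\<^sub>L T)) c"
        using exists_slices_small_perturbation[OF uc c(1)] by blast
      have "R1 o\<^sub>L R \<in> U n"
      proof -
        have "R1 o\<^sub>L (R o\<^sub>L T) = (R1 o\<^sub>L R) o\<^sub>L T" by (rule blinfun_eqI) simp
        then show ?thesis using R1(2) c(2) by (auto simp: U_def)
      qed
      moreover have "dist (R1 o\<^sub>L R) R < d"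
      proof -
        have "(R1 o\<^sub>L R) - R = (R1 - id_blinfun) o\<^sub>L R"
          by (rule blinfun_eqI) (simp add: blinfun.diff_left)
        then have "norm ((R1 o\<^sub>L R) - R) \<le> c * norm R"
          using norm_blinfun_compose[of "R1 - id_blinfun" R] mult_right_mono[OF R1(1) norm_ge_zero[of R]] by simp
        also have "\<dots> \<le> c * (norm R + 1)" using c by simp
        finally show ?thesis using cd d by (simp add: dist_norm)
      qed
      ultimately show ?thesis by blast
    qed
    then show ?thesis by (auto simp: closure_approachable)
  qed
  have "Met_TC.mtopology closure_of \<Inter>(range U) = UNIV"
    by (rule Met_TC.metric_Baire_category) (use op dense complete_UNIV in auto)
  then have "R0 \<in> closure (\<Inter>(range U))" by simp
  then obtain R where R: "R \<in> \<Inter>(range U)" "dist R R0 < e"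
    using e by (auto simp: closure_approachable)
  have "range_slices_small (R o\<^sub>L T) \<epsilon>" if e: "\<epsilon> > 0" for \<epsilon>
  proof -
    obtain n where n: "1 / real (Suc n) < \<epsilon>" using nat_approx_posE[OF e] by blast
    have "R \<in> U n" using R(1) by blast
    then show ?thesis using n unfolding U_def by (auto intro: range_slices_small_mono)
  qed
  with R(2) show ?thesis by (auto simp: dist_norm)
qed

text \<open>The signs are fixed by staying within \<open>\<parallel>S\<parallel> / 4\<close> of one image \<open>Sz\<^sub>0\<close>. After that the sum of two images
  is too large for the alternative with the plus sign, so the images form a Cauchy sequence.\<close>
lemma exists_Cauchy_maximising_sequence:
  fixes S :: "'z::real_normed_vector \<Rightarrow>\<^sub>L 'y::banach"
  assumes small: "\<And>\<epsilon>. \<epsilon> > 0 \<Longrightarrow> range_slices_small S \<epsilon>" and S: "S \<noteq> 0"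
  shows "\<exists>z y. (\<forall>n. norm (z n) \<le> 1) \<and> (\<lambda>n. blinfun_apply S (z n)) \<longlonglongrightarrow> y \<and> norm y = norm S"
proof -
  let ?S = "blinfun_apply S"
  have nS: "norm S > 0" using S by simp
  obtain \<theta> where \<theta>: "\<theta> > 0" and D: "\<And>z z'. norm z \<le> 1 \<Longrightarrow> norm z' \<le> 1 \<Longrightarrow>
     norm (?S z) > norm S - \<theta> \<Longrightarrow> norm (?S z') > norm S - \<theta> \<Longrightarrow>
     norm (?S z - ?S z') < norm S / 4 \<or> norm (?S z + ?S z') < norm S / 4"
    using range_slices_smallD[OF small[of "norm S / 4"]] nS by auto
  obtain z0 where z0: "norm z0 \<le> 1" "norm (?S z0) > norm S - min \<theta> (norm S / 4)"
    using exists_near_norm[of "min \<theta> (norm S / 4)" S] \<theta> nS by auto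
  have "\<exists>z. norm z \<le> 1 \<and> norm (?S z) > norm S - 1 / real (Suc n) \<and> norm (?S z - ?S z0) < norm S / 4" for n
  proof -
    obtain z where z: "norm z \<le> 1" "norm (?S z) > norm S - min \<theta> (1 / real (Suc n))"
      using exists_near_norm[of "min \<theta> (1 / real (Suc n))" S] \<theta> by auto
    have "norm (?S z - ?S z0) < norm S / 4 \<or> norm (?S z + ?S z0) < norm S / 4"
      using z z0 by (intro D) auto
    then show ?thesis
    proof
      assume "norm (?S z - ?S z0) < norm S / 4"
      with z show ?thesis by (intro exI[of _ z]) auto
    next
      assume "norm (?S z + ?S z0) < norm S / 4"
      then have "norm (?S (- z) - ?S z0) < norm S / 4"
        using norm_minus_cancel[of "?S z + ?S z0"] by (simp add: blinfun.minus_right)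
      with z show ?thesis by (intro exI[of _ "- z"]) (auto simp: blinfun.minus_right)
    qed
  qed
  then obtain z where z: "\<And>n. norm (z n) \<le> 1" "\<And>n. norm (?S (z n)) > norm S - 1 / real (Suc n)"
    "\<And>n. norm (?S (z n) - ?S z0) < norm S / 4" by metis
  have "Cauchy (\<lambda>n. ?S (z n))"
    unfolding Cauchy_def dist_norm
  proof (intro allI impI)
    fix e :: real assume e: "e > 0"
    obtain \<theta>' where \<theta>': "\<theta>' > 0" and D': "\<And>z z'. norm z \<le> 1 \<Longrightarrow> norm z' \<le> 1 \<Longrightarrow>
     norm (?S z) > norm S - \<theta>' \<Longrightarrow> norm (?S z') > norm S - \<theta>' \<Longrightarrow>
     norm (?S z - ?S z') < min e (norm S / 2) \<or> norm (?S z + ?S z') < min e (norm S / 2)"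
      using range_slices_smallD[OF small[of "min e (norm S / 2)"]] nS e by auto
    obtain N where N: "1 / real (Suc N) < \<theta>'" using nat_approx_posE[OF \<theta>'] by blast
    have near: "norm (?S (z n)) > norm S - \<theta>'" if "n \<ge> N" for n
    proof -
      have "1 / real (Suc n) \<le> 1 / real (Suc N)" using that by (simp add: field_simps)
      then show ?thesis using N z(2)[of n] by linarith
    qed
    have "norm (?S (z m) - ?S (z n)) < e" if "m \<ge> N" "n \<ge> N" for m n
    proof -
      have eq: "2 *\<^sub>R ?S z0 = (?S (z m) + ?S (z n)) - ((?S (z m) - ?S z0) + (?S (z n) - ?S z0))"
        by (simp add: scaleR_2)
      have "2 * norm (?S z0) \<le> norm (?S (z m) + ?S (z n)) + norm ((?S (z m) - ?S z0) + (?S (z n) - ?S z0))"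
        using norm_triangle_ineq4[of "?S (z m) + ?S (z n)" "(?S (z m) - ?S z0) + (?S (z n) - ?S z0)"]
        unfolding eq[symmetric] by simp
      then have "norm (?S (z m) + ?S (z n)) \<ge> norm S / 2"
        using norm_triangle_ineq[of "?S (z m) - ?S z0" "?S (z n) - ?S z0"] z(3)[of m] z(3)[of n] z0(2) nS
        by linarith
      then show ?thesis using D'[OF z(1) z(1) near[OF that(1)] near[OF that(2)]] by auto
    qed
    then show "\<exists>M. \<forall>m\<ge>M. \<forall>n\<ge>M. norm (?S (z m) - ?S (z n)) < e" by blast
  qed
  then obtain y where y: "(\<lambda>n. ?S (z n)) \<longlonglongrightarrow> y" using Cauchy_convergent_iff convergent_def by blast
  have "(\<lambda>n. norm S - 1 / real (Suc n)) \<longlonglongrightarrow> norm S - 0"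
    by (intro tendsto_intros LIMSEQ_inverse_real_of_nat[unfolded inverse_eq_divide])
  then have "norm S \<le> norm y"
    using LIMSEQ_le[OF _ tendsto_norm[OF y], of "\<lambda>n. norm S - 1 / real (Suc n)" "norm S"] z(2)
    by (auto intro: less_imp_le)
  moreover have "norm y \<le> norm S"
    by (rule LIMSEQ_le_const2[OF tendsto_norm[OF y]]) (use norm_blinfun_le_on_ball[OF z(1)] in auto)
  ultimately show ?thesis using y z(1) by (intro exI[of _ z] exI[of _ y]) auto
qed

text \<open>Comparing a maximising sequence with the norming vector \<open>x\<^sub>0\<close> shows that its images are eventually
  close to \<open>Sx\<^sub>0\<close> or to \<open>-Sx\<^sub>0\<close>; one of the two signs is the better one infinitely often.\<close>
lemma RSE_if_slices_small:
  fixes S :: "'z::real_normed_vector \<Rightarrow>\<^sub>L 'y::real_normed_vector"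
  assumes small: "\<And>\<epsilon>. \<epsilon> > 0 \<Longrightarrow> range_slices_small S \<epsilon>"
    and x0: "norm x0 = 1" "norm (blinfun_apply S x0) = norm S"
  shows "S \<in> RSE"
proof -
  let ?S = "blinfun_apply S"
  have "\<exists>\<sigma> \<theta>. strict_mono \<sigma> \<and> \<theta> \<in> {1, - 1 :: real} \<and> (\<lambda>n. ?S (x (\<sigma> n))) \<longlonglongrightarrow> \<theta> *\<^sub>R ?S x0"
    if x: "range x \<subseteq> cball 0 1" and lim: "(\<lambda>n. norm (?S (x n))) \<longlonglongrightarrow> norm S" for x :: "nat \<Rightarrow> 'z"
  proof -
    have "\<exists>\<theta>\<in>{1, -1}. infinite {n. norm (?S (x n) - \<theta> *\<^sub>R ?S x0) \<le> norm (?S (x n) + \<theta> *\<^sub>R ?S x0)}"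
    proof (rule ccontr)
      assume "\<not> ?thesis"
      then have "finite ({n. norm (?S (x n) - ?S x0) \<le> norm (?S (x n) + ?S x0)} \<union>
          {n. norm (?S (x n) + ?S x0) \<le> norm (?S (x n) - ?S x0)})" by auto
      moreover have "{n. norm (?S (x n) - ?S x0) \<le> norm (?S (x n) + ?S x0)} \<union>
          {n. norm (?S (x n) + ?S x0) \<le> norm (?S (x n) - ?S x0)} = (UNIV :: nat set)" by auto
      ultimately show False by simp
    qed
    then obtain \<theta> :: real where \<theta>: "\<theta> \<in> {1, -1}"
      and inf: "infinite {n. norm (?S (x n) - \<theta> *\<^sub>R ?S x0) \<le> norm (?S (x n) + \<theta> *\<^sub>R ?S x0)}" by blast
    obtain \<sigma> :: "nat \<Rightarrow> nat" where \<sigma>: "strict_mono \<sigma>"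
      and sel: "\<And>n. norm (?S (x (\<sigma> n)) - \<theta> *\<^sub>R ?S x0) \<le> norm (?S (x (\<sigma> n)) + \<theta> *\<^sub>R ?S x0)"
      using infinite_enumerate[OF inf] by auto
    have "(\<lambda>n. ?S (x (\<sigma> n))) \<longlonglongrightarrow> \<theta> *\<^sub>R ?S x0"
    proof (rule LIMSEQ_I)
      fix r :: real assume "r > 0"
      obtain t where t: "t > 0" and D: "\<And>z z'. norm z \<le> 1 \<Longrightarrow> norm z' \<le> 1 \<Longrightarrow>
        norm (?S z) > norm S - t \<Longrightarrow> norm (?S z') > norm S - t \<Longrightarrow>
        norm (?S z - ?S z') < r \<or> norm (?S z + ?S z') < r"
        using range_slices_smallD[OF small[OF \<open>r > 0\<close>]] by metis
      obtain N where N: "\<And>n. n \<ge> N \<Longrightarrow> norm (norm (?S (x n)) - norm S) < t"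
        using LIMSEQ_D[OF lim t] by blast
      have "norm (?S (x (\<sigma> n)) - \<theta> *\<^sub>R ?S x0) < r" if "n \<ge> N" for n
      proof -
        have "\<sigma> n \<ge> N" using that seq_suble[OF \<sigma>, of n] by linarith
        then have "norm (?S (x (\<sigma> n))) > norm S - t" using N[of "\<sigma> n"] by (simp add: abs_less_iff)
        moreover have "norm (x (\<sigma> n)) \<le> 1" using subsetD[OF x rangeI, of "\<sigma> n"] by simp
        ultimately have "norm (?S (x (\<sigma> n)) - ?S x0) < r \<or> norm (?S (x (\<sigma> n)) + ?S x0) < r"
          using x0 t by (intro D) auto
        then show ?thesis using sel[of n] \<theta> by auto
      qed
      then show "\<exists>N. \<forall>n\<ge>N. norm (?S (x (\<sigma> n)) - \<theta> *\<^sub>R ?S x0) < r" by blast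
    qed
    with \<sigma> \<theta> show ?thesis by blast
  qed
  then show ?thesis unfolding RSE_def using x0(1) by (auto intro!: bexI[of _ x0])
qed

section \<open>Spaces with coordinates and the supremum norm\<close>

text \<open>A \<open>c\<^sub>0\<close>-type sum of copies of \<open>X\<close>. The finiteness assumption \<open>finite_large\<close> expresses that the
  coordinates tend to zero, without an order on the index set.\<close>
locale sup_coordinates =
  fixes nth :: "'z::real_normed_vector \<Rightarrow> 'i \<Rightarrow> 'x::real_normed_vector"
  assumes nth_add: "nth (a + b) i = nth a i + nth b i"
    and nth_scaleR: "nth (r *\<^sub>R a) i = r *\<^sub>R nth a i"
    and norm_nth_le: "norm (nth a i) \<le> norm a"
    and norm_le: "(\<And>i. norm (nth a i) \<le> K) \<Longrightarrow> norm a \<le> K"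
    and finite_large: "r > 0 \<Longrightarrow> finite {i. norm (nth a i) \<ge> r}"
    and restrict_exists: "\<exists>b. \<forall>i. nth b i = (if i \<in> B then nth a i else 0)"
    and single_exists: "\<exists>b. \<forall>i. nth b i = (if i = j then x else 0)"
begin

definition coord :: "'i \<Rightarrow> 'z \<Rightarrow>\<^sub>L 'x" where
  "coord i = Blinfun (\<lambda>z. nth z i)"

definition proj :: "'i set \<Rightarrow> 'z \<Rightarrow>\<^sub>L 'z" where
  "proj B = Blinfun (\<lambda>a. SOME b. \<forall>i. nth b i = (if i \<in> B then nth a i else 0))"

definition single :: "'i \<Rightarrow> 'x \<Rightarrow>\<^sub>L 'z" where
  "single j = Blinfun (\<lambda>x. SOME b. \<forall>i. nth b i = (if i = j then x else 0))"

lemma coord_apply: "blinfun_apply (coord i) z = nth z i"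
proof -
  have "bounded_linear (\<lambda>z. nth z i)"
    by (rule bounded_linear_intro[of _ 1]) (simp_all add: nth_add nth_scaleR norm_nth_le)
  then show ?thesis by (simp add: coord_def bounded_linear_Blinfun_apply)
qed

lemma nth_diff: "nth (a - b) i = nth a i - nth b i"
  and nth_sum: "nth (sum f F) i = (\<Sum>k\<in>F. nth (f k) i)"
  by (simp_all add: coord_apply[symmetric] blinfun.diff_right blinfun.sum_right)

lemma nth_eqI: "(\<And>i. nth a i = nth b i) \<Longrightarrow> a = b"
  using norm_le[of "a - b" 0] by (simp add: nth_diff)

lemma nth_proj: "nth (blinfun_apply (proj B) a) i = (if i \<in> B then nth a i else 0)"
proof -
  let ?p = "\<lambda>a. SOME b. \<forall>i. nth b i = (if i \<in> B then nth a i else 0)"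
  have p: "nth (?p a) i = (if i \<in> B then nth a i else 0)" for a i
    using someI_ex[OF restrict_exists[of B a]] by blast
  have "bounded_linear ?p"
  proof (rule bounded_linear_intro[of _ 1])
    show "?p (a + b) = ?p a + ?p b" for a b by (rule nth_eqI) (simp add: p nth_add)
    show "?p (r *\<^sub>R a) = r *\<^sub>R ?p a" for r a by (rule nth_eqI) (simp add: p nth_scaleR)
    show "norm (?p a) \<le> norm a * 1" for a by (rule norm_le) (simp add: p norm_nth_le)
  qed
  then show ?thesis by (simp add: proj_def bounded_linear_Blinfun_apply p)
qed

lemma nth_single: "nth (blinfun_apply (single j) x) i = (if i = j then x else 0)"
proof -
  let ?s = "\<lambda>x. SOME b. \<forall>i. nth b i = (if i = j then x else 0)"
  have s: "nth (?s x) i = (if i = j then x else 0)" for x i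
    using someI_ex[OF single_exists[of j x]] by blast
  have "bounded_linear ?s"
  proof (rule bounded_linear_intro[of _ 1])
    show "?s (a + b) = ?s a + ?s b" for a b by (rule nth_eqI) (simp add: s nth_add)
    show "?s (r *\<^sub>R a) = r *\<^sub>R ?s a" for r a by (rule nth_eqI) (simp add: s nth_scaleR)
    show "norm (?s a) \<le> norm a * 1" for a by (rule norm_le) (simp add: s)
  qed
  then show ?thesis by (simp add: single_def bounded_linear_Blinfun_apply s)
qed

lemma norm_single: "norm (blinfun_apply (single j) x) = norm x"
  using norm_nth_le[of "blinfun_apply (single j) x" j]
  by (intro antisym norm_le) (auto simp: nth_single)

lemma norm_proj_le: "norm (proj B) \<le> 1"
  by (rule norm_blinfun_le_if_ball, rule norm_le)
    (auto simp: nth_proj intro: order_trans[OF norm_nth_le])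

lemma proj_add_proj_compl: "blinfun_apply (proj B) a + blinfun_apply (proj (- B)) a = a"
  by (rule nth_eqI) (simp add: nth_add nth_proj)

lemma norm_compose_proj_le: "norm (T o\<^sub>L proj B) \<le> norm T"
  using norm_blinfun_compose[of T "proj B"] mult_left_mono[OF norm_proj_le norm_ge_zero[of T]]
  by (simp add: order_trans)

text \<open>If the coordinates of \<open>c\<close> in \<open>B\<close> have norm at most \<open>1 - t\<close>, then \<open>c \<plusminus> t v\<close> is in the ball for every
  \<open>v\<close> of the ball supported in \<open>B\<close>. Hence \<open>T c\<close> is the midpoint of a segment of the unit ball of \<open>Y\<close> with
  direction \<open>t T v\<close>, which is short. The bound depends on \<open>t\<close> but not on the size of \<open>B\<close>.\<close>
lemma operator_small_off_support:
  assumes uc: "uniformly_convex TYPE('y::real_normed_vector)" and e: "e > (0::real)"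
  shows "\<exists>\<eta>>0. \<forall>(T :: 'z \<Rightarrow>\<^sub>L 'y) c B t. norm T \<le> 1 \<longrightarrow> norm c \<le> 1 \<longrightarrow> 0 < t \<longrightarrow>
     (\<forall>i\<in>B. norm (nth c i) \<le> 1 - t) \<longrightarrow> norm (blinfun_apply T c) > 1 - \<eta> \<longrightarrow> norm (T o\<^sub>L proj B) \<le> e / t"
proof -
  obtain d where d: "d > 0" and D: "\<And>c v :: 'y. norm (c + v) \<le> 1 \<Longrightarrow> norm (c - v) \<le> 1 \<Longrightarrow>
      norm c > 1 - d \<Longrightarrow> norm v < e"
    using uniformly_convex_direction[OF uc e] by metis
  have "norm (T o\<^sub>L proj B) \<le> e / t"
    if T: "norm T \<le> 1" and c: "norm c \<le> 1" and t: "0 < t" and B: "\<And>i. i \<in> B \<Longrightarrow> norm (nth c i) \<le> 1 - t"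
      and Tc: "norm (blinfun_apply T c) > 1 - d" for T :: "'z \<Rightarrow>\<^sub>L 'y" and c B t
  proof (rule norm_blinfun_le_if_ball)
    fix z :: 'z assume z: "norm z \<le> 1"
    have in_ball: "norm (c + s *\<^sub>R blinfun_apply (proj B) z) \<le> 1" if s: "\<bar>s\<bar> = t" for s
    proof (rule norm_le)
      fix i
      show "norm (nth (c + s *\<^sub>R blinfun_apply (proj B) z) i) \<le> 1"
      proof (cases "i \<in> B")
        case True
        have "norm (nth c i + s *\<^sub>R nth z i) \<le> norm (nth c i) + t * norm (nth z i)"
          using norm_triangle_ineq[of "nth c i" "s *\<^sub>R nth z i"] s by simp
        also have "\<dots> \<le> (1 - t) + t * 1"
          using B[OF True] z norm_nth_le[of z i] t by (intro add_mono mult_left_mono) auto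
        finally show ?thesis using True by (simp add: nth_add nth_scaleR nth_proj)
      next
        case False
        then show ?thesis using c norm_nth_le[of c i] by (simp add: nth_add nth_scaleR nth_proj)
      qed
    qed
    have "norm (blinfun_apply T (t *\<^sub>R blinfun_apply (proj B) z)) < e"
    proof (rule D[OF _ _ Tc])
      show "norm (blinfun_apply T c + blinfun_apply T (t *\<^sub>R blinfun_apply (proj B) z)) \<le> 1"
        using norm_blinfun_le_on_ball[OF in_ball[of t], of T] t T by (simp add: blinfun.add_right)
      show "norm (blinfun_apply T c - blinfun_apply T (t *\<^sub>R blinfun_apply (proj B) z)) \<le> 1"
        using norm_blinfun_le_on_ball[OF in_ball[of "- t"], of T] t T by (simp add: blinfun.diff_right)
    qed
    then show "norm (blinfun_apply (T o\<^sub>L proj B) z) \<le> e / t"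
      using t by (simp add: blinfun.scaleR_right field_simps)
  qed
  with d show ?thesis by (intro exI[of _ d]) auto
qed

lemma compose_proj_compl: "T o\<^sub>L proj (- B) = T - (T o\<^sub>L proj B)"
proof (rule blinfun_eqI)
  fix a
  have "blinfun_apply T a = blinfun_apply T (blinfun_apply (proj B) a + blinfun_apply (proj (- B)) a)"
    by (simp only: proj_add_proj_compl)
  then show "blinfun_apply (T o\<^sub>L proj (- B)) a = blinfun_apply (T - (T o\<^sub>L proj B)) a"
    by (simp add: blinfun.add_right blinfun.diff_left)
qed

lemma finite_coordinates_approximation:
  assumes uc: "uniformly_convex TYPE('y::real_normed_vector)" and e: "e > (0::real)"
  shows "\<exists>\<eta>>0. \<forall>(T :: 'z \<Rightarrow>\<^sub>L 'y) x. norm T \<le> 1 \<longrightarrow> norm x \<le> 1 \<longrightarrow>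
     norm (blinfun_apply T x) > 1 - \<eta> \<longrightarrow> (\<exists>A. finite A \<and> norm (T - (T o\<^sub>L proj A)) \<le> e)"
proof -
  obtain \<eta> where \<eta>: "\<eta> > 0" and small: "\<And>(T :: 'z \<Rightarrow>\<^sub>L 'y) c B t. norm T \<le> 1 \<Longrightarrow> norm c \<le> 1 \<Longrightarrow> 0 < t \<Longrightarrow>
     (\<forall>i\<in>B. norm (nth c i) \<le> 1 - t) \<Longrightarrow> norm (blinfun_apply T c) > 1 - \<eta> \<Longrightarrow> norm (T o\<^sub>L proj B) \<le> (e / 2) / t"
    using operator_small_off_support[OF uc, of "e / 2"] e by (metis half_gt_zero)
  have "\<exists>A. finite A \<and> norm (T - (T o\<^sub>L proj A)) \<le> e"
    if "norm T \<le> 1" "norm x \<le> 1" "norm (blinfun_apply T x) > 1 - \<eta>" for T :: "'z \<Rightarrow>\<^sub>L 'y" and x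
  proof (intro exI conjI)
    let ?A = "{i. norm (nth x i) \<ge> 1 / 2}"
    show "finite ?A" by (rule finite_large) simp
    have "norm (T o\<^sub>L proj (- ?A)) \<le> (e / 2) / (1 / 2)"
      by (rule small) (use that in auto)
    then show "norm (T - (T o\<^sub>L proj ?A)) \<le> e" by (simp add: compose_proj_compl)
  qed
  with \<eta> show ?thesis by blast
qed

end

text \<open>Such a functional is a finite sum of functionals of the single coordinates, and each of them may be
  maximised independently in a supremum norm.\<close>
lemma (in sup_coordinates) functional_attains_norm:
  fixes g :: "'z \<Rightarrow>\<^sub>L real"
  assumes att: "\<And>f :: 'x \<Rightarrow>\<^sub>L real. \<exists>v. norm v \<le> 1 \<and> blinfun_apply f v = norm f"
    and A: "finite A" and g: "g o\<^sub>L proj A = g"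
  shows "\<exists>v. norm v \<le> 1 \<and> blinfun_apply g v = norm g"
proof -
  let ?g = "\<lambda>i. g o\<^sub>L single i"
  obtain v where v: "\<And>i. norm (v i) \<le> 1" "\<And>i. blinfun_apply (?g i) (v i) = norm (?g i)"
  proof -
    have "\<exists>v. norm v \<le> 1 \<and> blinfun_apply (?g i) v = norm (?g i)" for i by (rule att)
    then show ?thesis using that by metis
  qed
  define w where "w = (\<Sum>i\<in>A. blinfun_apply (single i) (v i))"
  have nth_w: "nth w i = (if i \<in> A then v i else 0)" for i
    using A by (simp add: w_def nth_sum nth_single if_distrib cong: if_cong)
  have w: "norm w \<le> 1" by (rule norm_le) (simp add: nth_w v)
  have "norm (blinfun_apply g z) \<le> blinfun_apply g w" if z: "norm z \<le> 1" for z
  proof -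
    have "blinfun_apply (proj A) z = (\<Sum>i\<in>A. blinfun_apply (single i) (nth z i))"
      by (rule nth_eqI) (use A in \<open>simp add: nth_proj nth_sum nth_single if_distrib cong: if_cong\<close>)
    then have "blinfun_apply g z = (\<Sum>i\<in>A. blinfun_apply (?g i) (nth z i))"
      using arg_cong[OF g, of "\<lambda>h. blinfun_apply h z"] by (simp add: blinfun.sum_right)
    also have "norm \<dots> \<le> (\<Sum>i\<in>A. norm (?g i))"
      by (intro sum_norm_le norm_blinfun_le_on_ball order_trans[OF norm_nth_le z])
    also have "\<dots> = blinfun_apply g w"
      by (simp add: w_def blinfun.sum_right v(2)[symmetric])
    finally show ?thesis .
  qed
  then have "norm g \<le> blinfun_apply g w" by (rule norm_blinfun_le_if_ball)
  moreover have "blinfun_apply g w \<le> norm g" using norm_blinfun_le_on_ball[OF w, of g] by simp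
  ultimately show ?thesis using w by (intro exI[of _ w]) simp
qed

text \<open>The limit \<open>y\<close> of the images of a maximising sequence need not be known to be an image. A functional \<open>f\<close>
  norming \<open>y\<close> makes \<open>f \<circ> S\<close> a functional of norm at least \<open>\<parallel>S\<parallel>\<close>, and any vector norming it
  norms \<open>S\<close>.\<close>
lemma (in sup_coordinates) operator_attains_norm:
  fixes S :: "'z \<Rightarrow>\<^sub>L 'y::banach"
  assumes att: "\<And>f :: 'x \<Rightarrow>\<^sub>L real. \<exists>v. norm v \<le> 1 \<and> blinfun_apply f v = norm f"
    and small: "\<And>\<epsilon>. \<epsilon> > 0 \<Longrightarrow> range_slices_small S \<epsilon>" and S: "S \<noteq> 0"
    and A: "finite A" "S o\<^sub>L proj A = S"
  shows "\<exists>v. norm v \<le> 1 \<and> norm (blinfun_apply S v) = norm S"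
proof -
  obtain z y where z: "\<And>n. norm (z n) \<le> 1" and y: "(\<lambda>n. blinfun_apply S (z n)) \<longlonglongrightarrow> y" "norm y = norm S"
    using exists_Cauchy_maximising_sequence[OF small S] by blast
  obtain f :: "'y \<Rightarrow>\<^sub>L real" where f: "norm f \<le> 1" "blinfun_apply f y = norm y"
    using exists_norming_functional by blast
  have "(f o\<^sub>L S) o\<^sub>L proj A = f o\<^sub>L (S o\<^sub>L proj A)" by (rule blinfun_eqI) simp
  then obtain v where v: "norm v \<le> 1" "blinfun_apply (f o\<^sub>L S) v = norm (f o\<^sub>L S)"
    using functional_attains_norm[OF att A(1), of "f o\<^sub>L S"] A(2) by auto
  have "(\<lambda>n. blinfun_apply f (blinfun_apply S (z n))) \<longlonglongrightarrow> norm S"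
    using blinfun.tendsto[OF tendsto_const y(1), of f] f y by simp
  moreover have "blinfun_apply f (blinfun_apply S (z n)) \<le> norm (f o\<^sub>L S)" for n
    using norm_blinfun_le_on_ball[OF z[of n], of "f o\<^sub>L S"] by simp
  ultimately have "norm S \<le> norm (f o\<^sub>L S)" by (intro LIMSEQ_le_const2) auto
  also have "\<dots> = blinfun_apply f (blinfun_apply S v)" using v by simp
  also have "\<dots> \<le> norm (blinfun_apply S v)"
    using norm_blinfun[of f "blinfun_apply S v"] mult_right_mono[OF f(1) norm_ge_zero[of "blinfun_apply S v"]] by simp
  finally show ?thesis using v norm_blinfun_le_on_ball[OF v(1), of S] by (intro exI[of _ v]) simp
qed

text \<open>On the coordinates where \<open>z\<close> is far from \<open>x\<close>, their midpoint is bounded away from norm one, so \<open>S\<close> is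
  small on vectors supported there. This leaves the freedom to precompose \<open>S\<close> on those coordinates
  with any contraction at little cost. The one chosen sends the corrected vector \<open>x\<^sub>0\<close> to \<open>z\<close>, so the new
  operator attains its norm at \<open>x\<^sub>0\<close>; and since its images of the ball are images of the ball
  under \<open>S\<close>, it inherits the small range slices.\<close>
lemma (in sup_coordinates) relocate_norm_attainment:
  assumes ucX: "uniformly_convex TYPE('x)" and ucY: "uniformly_convex TYPE('y::real_normed_vector)"
    and e: "e > (0::real)"
  shows "\<exists>\<eta>>0. \<forall>(S :: 'z \<Rightarrow>\<^sub>L 'y) z x. norm S = 1 \<longrightarrow> (\<forall>\<epsilon>>0. range_slices_small S \<epsilon>) \<longrightarrow>
     norm z \<le> 1 \<longrightarrow> norm (blinfun_apply S z) = 1 \<longrightarrow> norm x = 1 \<longrightarrow>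
     norm (blinfun_apply S (z + x)) > 2 - \<eta> \<longrightarrow>
     (\<exists>S'\<in>RSE. \<exists>x0. norm x0 = 1 \<and> norm S' = 1 \<and> norm (blinfun_apply S' x0) = 1 \<and>
        norm (S' - S) < e \<and> norm (x - x0) < e)"
proof -
  obtain d where d: "d > 0" and D: "\<And>a b :: 'x. norm a \<le> 1 \<Longrightarrow> norm b \<le> 1 \<Longrightarrow>
      norm (a + b) > 2 - d \<Longrightarrow> norm (a - b) < e / 2"
    using uniformly_convex_ball[OF ucX, of "e / 2"] e by (metis half_gt_zero)
  define q where "q = min (e / 4) (1 / 2)"
  have q: "q > 0" "q \<le> e / 4" "q \<le> 1 / 2" using e by (auto simp: q_def)
  have "q * (d / 2) > 0" using q d by simp
  from operator_small_off_support[OF ucY this] obtain \<eta> where \<eta>: "\<eta> > 0"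
    and small: "\<And>(T :: 'z \<Rightarrow>\<^sub>L 'y) c B t. norm T \<le> 1 \<Longrightarrow> norm c \<le> 1 \<Longrightarrow> 0 < t \<Longrightarrow>
     (\<forall>i\<in>B. norm (nth c i) \<le> 1 - t) \<Longrightarrow> norm (blinfun_apply T c) > 1 - \<eta> \<Longrightarrow> norm (T o\<^sub>L proj B) \<le> q * (d / 2) / t"
    by metis
  have "\<exists>S'\<in>RSE. \<exists>x0. norm x0 = 1 \<and> norm S' = 1 \<and> norm (blinfun_apply S' x0) = 1 \<and>
        norm (S' - S) < e \<and> norm (x - x0) < e"
    if nS: "norm S = 1" and slices: "\<And>\<epsilon>. \<epsilon> > 0 \<Longrightarrow> range_slices_small S \<epsilon>"
      and z: "norm z \<le> 1" and Sz: "norm (blinfun_apply S z) = 1" and x: "norm x = 1"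
      and near: "norm (blinfun_apply S (z + x)) > 2 - 2 * \<eta>" for S :: "'z \<Rightarrow>\<^sub>L 'y" and z x
  proof -
    have zi: "norm (nth z i) \<le> 1" and xi: "norm (nth x i) \<le> 1" for i
      using norm_nth_le[of z i] norm_nth_le[of x i] z x by auto
    define G where "G = {i. norm (nth z i - nth x i) < e / 2}"
    define c where "c = (1 / 2) *\<^sub>R (z + x)"
    have off: "norm (S o\<^sub>L proj (- G)) \<le> q"
    proof -
      have "norm (S o\<^sub>L proj (- G)) \<le> q * (d / 2) / (d / 2)"
      proof (rule small)
        show "norm c \<le> 1" using norm_triangle_ineq[of z x] z x by (simp add: c_def)
        show "\<forall>i\<in>- G. norm (nth c i) \<le> 1 - d / 2"
          using D[OF zi xi] by (fastforce simp: G_def c_def nth_add nth_scaleR not_less)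
        show "norm (blinfun_apply S c) > 1 - \<eta>" using near by (simp add: c_def blinfun.scaleR_right)
      qed (use nS d in auto)
      then show ?thesis using d by simp
    qed
    define x0 where "x0 = blinfun_apply (proj G) z + blinfun_apply (proj (- G)) x"
    have x0i: "nth x0 i = (if i \<in> G then nth z i else nth x i)" for i
      by (simp add: x0_def nth_add nth_proj)
    have "norm (x - x0) \<le> e / 2"
      by (rule norm_le) (use e in \<open>auto simp: nth_diff x0i G_def norm_minus_commute\<close>)
    then have close: "norm (x - x0) < e" using e by simp
    \<comment> \<open>Otherwise all coordinates of \<open>z\<close> in \<open>G\<close> have norm at most \<open>\<parallel>x0\<parallel> < 1\<close>; since \<open>z\<close> norms \<open>S\<close> exactly, \<open>S\<close>
      vanishes on vectors supported in \<open>G\<close>, and it is small on those supported off \<open>G\<close>.\<close>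
    have nx0: "norm x0 = 1"
    proof (rule ccontr)
      assume "norm x0 \<noteq> 1"
      moreover have "norm x0 \<le> 1" by (rule norm_le) (simp add: x0i zi xi)
      ultimately have lt: "norm x0 < 1" by simp
      have zG: "\<forall>i\<in>G. norm (nth z i) \<le> 1 - (1 - norm x0)"
      proof
        fix i assume "i \<in> G"
        then show "norm (nth z i) \<le> 1 - (1 - norm x0)" using norm_nth_le[of x0 i] by (simp add: x0i)
      qed
      have "norm (S o\<^sub>L proj G) \<le> 0 + r" if r: "r > 0" for r
      proof -
        have "r * (1 - norm x0) > 0" using r lt by simp
        from operator_small_off_support[OF ucY this] obtain \<eta>' where "\<eta>' > 0"
          and small': "\<And>(T :: 'z \<Rightarrow>\<^sub>L 'y) c B t. norm T \<le> 1 \<Longrightarrow> norm c \<le> 1 \<Longrightarrow> 0 < t \<Longrightarrow>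
            (\<forall>i\<in>B. norm (nth c i) \<le> 1 - t) \<Longrightarrow> norm (blinfun_apply T c) > 1 - \<eta>' \<Longrightarrow>
            norm (T o\<^sub>L proj B) \<le> r * (1 - norm x0) / t"
          by blast
        have "norm (S o\<^sub>L proj G) \<le> r * (1 - norm x0) / (1 - norm x0)"
          by (rule small'[OF _ z _ zG]) (use nS Sz lt \<open>\<eta>' > 0\<close> in auto)
        then show ?thesis using lt by simp
      qed
      then have "norm (S o\<^sub>L proj G) \<le> 0" by (rule field_le_epsilon)
      then have "S o\<^sub>L proj (- G) = S" by (simp add: compose_proj_compl)
      then show False using off q nS by simp
    qed
    obtain f :: "'z \<Rightarrow>\<^sub>L real" where f: "norm f \<le> 1" "blinfun_apply f x0 = 1"
      using exists_norming_functional[of x0] nx0 by auto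
    have f_le: "\<bar>blinfun_apply f a\<bar> \<le> norm a" for a
      using norm_blinfun[of f a] mult_right_mono[OF f(1) norm_ge_zero[of a]] by simp
    \<comment> \<open>The functional \<open>f\<close> takes the value one at \<open>x0\<close>, so \<open>M\<close> puts the coordinates of \<open>z\<close> off \<open>G\<close> back in
      place when it is applied to \<open>x0\<close>; and it maps the ball into itself, because it acts on each
      coordinate as the identity or as \<open>f\<close> times a vector of the ball.\<close>
    define M where "M = proj G + (blinfun_scaleR_left (blinfun_apply (proj (- G)) z) o\<^sub>L f)"
    have M: "blinfun_apply M a = blinfun_apply (proj G) a + blinfun_apply f a *\<^sub>R blinfun_apply (proj (- G)) z" for a
      by (simp add: M_def blinfun.add_left)
    have nM: "norm (blinfun_apply M a) \<le> 1" if a: "norm a \<le> 1" for a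
    proof (rule norm_le)
      fix i
      have "\<bar>blinfun_apply f a\<bar> * norm (nth z i) \<le> 1 * 1"
        using f_le[of a] a zi[of i] by (intro mult_mono) auto
      then show "norm (nth (blinfun_apply M a) i) \<le> 1"
        using norm_nth_le[of a i] a by (simp add: M nth_add nth_scaleR nth_proj)
    qed
    have Mx0: "blinfun_apply M x0 = z"
      by (rule nth_eqI) (simp add: M nth_add nth_scaleR nth_proj x0i f)
    define S' where "S' = S o\<^sub>L M"
    have S'apply: "blinfun_apply S' a = blinfun_apply S (blinfun_apply M a)" for a
      by (simp add: S'_def)
    have S'x0: "norm (blinfun_apply S' x0) = 1" by (simp add: S'_def Mx0 Sz)
    have nS': "norm S' = 1"
    proof (rule antisym)
      show "norm S' \<le> 1"
        by (rule norm_blinfun_le_if_ball)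
          (use norm_blinfun_le_on_ball[OF nM, of _ S] nS in \<open>simp add: S'_def\<close>)
      show "1 \<le> norm S'" using norm_blinfun_le_on_ball[of x0 S'] nx0 S'x0 by simp
    qed
    have "range_slices_small S' \<epsilon>" if "\<epsilon> > 0" for \<epsilon>
      using slices[OF that] nM
      unfolding range_slices_small_def nS nS' S'apply by meson
    then have "S' \<in> RSE" using nx0 S'x0 nS' by (intro RSE_if_slices_small[of _ x0]) auto
    moreover have "norm (S' - S) < e"
    proof -
      have "norm (S' - S) \<le> q * 2"
      proof (rule norm_blinfun_le_if_ball)
        fix a :: 'z assume a: "norm a \<le> 1"
        have "blinfun_apply M a - a = blinfun_apply (proj (- G)) (blinfun_apply f a *\<^sub>R z - a)"
          by (rule nth_eqI) (simp add: M nth_add nth_diff nth_scaleR nth_proj)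
        then have "blinfun_apply (S' - S) a = blinfun_apply (S o\<^sub>L proj (- G)) (blinfun_apply f a *\<^sub>R z - a)"
          by (simp add: S'_def blinfun.diff_left blinfun.diff_right[symmetric])
        also have "norm \<dots> \<le> norm (S o\<^sub>L proj (- G)) * norm (blinfun_apply f a *\<^sub>R z - a)"
          by (rule norm_blinfun)
        also have "\<dots> \<le> q * 2"
        proof (rule mult_mono[OF off])
          have "\<bar>blinfun_apply f a\<bar> * norm z \<le> 1 * 1" using f_le[of a] a z by (intro mult_mono) auto
          then show "norm (blinfun_apply f a *\<^sub>R z - a) \<le> 2"
            using norm_triangle_ineq4[of "blinfun_apply f a *\<^sub>R z" a] a by simp
        qed (use q in auto)
        finally show "norm (blinfun_apply (S' - S) a) \<le> q * 2" .
      qed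
      then show ?thesis using q e by linarith
    qed
    ultimately show ?thesis using nx0 nS' S'x0 close by blast
  qed
  then show ?thesis using \<eta> by (intro exI[of _ "2 * \<eta>"]) auto
qed

text \<open>The constants are chosen backwards: \<open>\<alpha>\<close> for the relocation, \<open>\<kappa>\<close> for the perturbations on \<open>Y\<close>, \<open>\<beta>\<close> for
  the localisation at \<open>x\<close>, and \<open>\<gamma>\<close> for the reduction to finitely many coordinates.\<close>
theorem (in sup_coordinates) BPBp_RSE_if_uniformly_convex:
  assumes att: "\<And>f :: 'x \<Rightarrow>\<^sub>L real. \<exists>v. norm v \<le> 1 \<and> blinfun_apply f v = norm f"
    and ucX: "uniformly_convex TYPE('x)" and ucY: "uniformly_convex TYPE('y::banach)"
  shows "BPBp_RSE TYPE('z) TYPE('y)"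
  unfolding BPBp_RSE_def
proof (intro allI impI)
  fix \<epsilon> :: real assume \<epsilon>: "\<epsilon> > 0"
  obtain \<alpha> where \<alpha>: "\<alpha> > 0" and relocate: "\<And>(S :: 'z \<Rightarrow>\<^sub>L 'y) z x. norm S = 1 \<Longrightarrow> (\<forall>\<epsilon>>0. range_slices_small S \<epsilon>) \<Longrightarrow>
     norm z \<le> 1 \<Longrightarrow> norm (blinfun_apply S z) = 1 \<Longrightarrow> norm x = 1 \<Longrightarrow>
     norm (blinfun_apply S (z + x)) > 2 - \<alpha> \<Longrightarrow>
     (\<exists>S'\<in>RSE. \<exists>x0. norm x0 = 1 \<and> norm S' = 1 \<and> norm (blinfun_apply S' x0) = 1 \<and>
        norm (S' - S) < \<epsilon> / 2 \<and> norm (x - x0) < \<epsilon> / 2)"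
    using relocate_norm_attainment[OF ucX ucY, of "\<epsilon> / 2"] \<epsilon> by (metis half_gt_zero)
  \<comment> \<open>Below, the errors add up to \<open>\<parallel>S - T\<parallel> \<le> 6 \<kappa>\<close> and \<open>\<parallel>Sz - Sx\<parallel> < 11 \<kappa>\<close>.\<close>
  define \<kappa> where "\<kappa> = min (min (\<epsilon> / 2) \<alpha>) 1 / 16"
  have \<kappa>: "\<kappa> > 0" "16 * \<kappa> \<le> \<epsilon> / 2" "16 * \<kappa> \<le> \<alpha>" "16 * \<kappa> \<le> 1"
    using \<epsilon> \<alpha> by (auto simp: \<kappa>_def)
  obtain \<beta> where \<beta>: "\<beta> > 0" and localise: "\<And>(T :: 'z \<Rightarrow>\<^sub>L 'y) x. norm T \<le> 1 \<Longrightarrow> norm x \<le> 1 \<Longrightarrow>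
     norm (blinfun_apply T x) > 1 - \<beta> \<Longrightarrow>
     (\<exists>R :: 'y \<Rightarrow>\<^sub>L 'y. norm (R - id_blinfun) \<le> \<kappa> \<and>
        (\<exists>\<theta>>0. \<forall>z. norm z \<le> 1 \<longrightarrow> norm (blinfun_apply R (blinfun_apply T z)) > norm (R o\<^sub>L T) - \<theta> \<longrightarrow>
            norm (blinfun_apply T z - blinfun_apply T x) < \<kappa> \<or> norm (blinfun_apply T z + blinfun_apply T x) < \<kappa>))"
    using exists_localising_perturbation[OF ucY \<kappa>(1)] by metis
  define \<mu> where "\<mu> = min \<kappa> (\<beta> / 2)"
  have \<mu>: "\<mu> > 0" "\<mu> \<le> \<kappa>" "2 * \<mu> \<le> \<beta>" using \<kappa> \<beta> by (auto simp: \<mu>_def)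
  obtain \<gamma> where \<gamma>: "\<gamma> > 0" and cut: "\<And>(T :: 'z \<Rightarrow>\<^sub>L 'y) x. norm T \<le> 1 \<Longrightarrow> norm x \<le> 1 \<Longrightarrow>
     norm (blinfun_apply T x) > 1 - \<gamma> \<Longrightarrow> (\<exists>A. finite A \<and> norm (T - (T o\<^sub>L proj A)) \<le> \<mu>)"
    using finite_coordinates_approximation[OF ucY \<mu>(1)] by metis
  define \<eta> where "\<eta> = min (min \<mu> \<gamma>) (\<epsilon> / 2)"
  have \<eta>: "0 < \<eta>" "\<eta> < \<epsilon>" "\<eta> \<le> \<mu>" "\<eta> \<le> \<gamma>" using \<mu> \<gamma> \<epsilon> by (auto simp: \<eta>_def)
  show "\<exists>\<eta>. 0 < \<eta> \<and> \<eta> < \<epsilon> \<and> (\<forall>(T :: 'z \<Rightarrow>\<^sub>L 'y) x. norm T = 1 \<longrightarrow> x \<in> sphere 0 1 \<longrightarrow>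
        norm (blinfun_apply T x) > 1 - \<eta> \<longrightarrow>
        (\<exists>S \<in> RSE. \<exists>x0 \<in> sphere 0 1.
          norm S = 1 \<and> norm (blinfun_apply S x0) = 1 \<and> norm (S - T) < \<epsilon> \<and> norm (x - x0) < \<epsilon>))"
  proof (rule exI[of _ \<eta>], intro conjI allI impI \<eta>(1,2))
    fix T :: "'z \<Rightarrow>\<^sub>L 'y" and x :: 'z
    assume nT: "norm T = 1" and "x \<in> sphere 0 1" and Tx: "norm (blinfun_apply T x) > 1 - \<eta>"
    then have nx: "norm x = 1" by simp
    obtain A where A: "finite A" "norm (T - (T o\<^sub>L proj A)) \<le> \<mu>"
      using cut[of T x] nT nx Tx \<eta> by auto
    define T1 where "T1 = T o\<^sub>L proj A"
    have T1A: "T1 o\<^sub>L proj A = T1"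
      by (rule blinfun_eqI) (auto simp: T1_def nth_proj intro!: arg_cong[of _ _ "blinfun_apply T"] nth_eqI)
    have nT1: "norm T1 \<le> 1" using norm_compose_proj_le[of T A] nT by (simp add: T1_def)
    have TT1: "norm (T1 - T) \<le> \<mu>" using A(2) by (simp add: T1_def norm_minus_commute)
    have "norm (blinfun_apply T x) \<le> norm (blinfun_apply T1 x) + \<mu>"
      using norm_blinfun_le_on_ball[of x "T1 - T"] nx TT1
        norm_triangle_sub[of "blinfun_apply T x" "blinfun_apply T1 x"]
      by (simp add: blinfun.diff_left norm_minus_commute)
    then have "norm (blinfun_apply T1 x) > 1 - \<beta>" using Tx \<eta> \<mu> by linarith
    then obtain R0 :: "'y \<Rightarrow>\<^sub>L 'y" and \<theta> where R0: "norm (R0 - id_blinfun) \<le> \<kappa>" and \<theta>: "\<theta> > 0"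
      and local: "\<And>z. norm z \<le> 1 \<Longrightarrow> norm (blinfun_apply R0 (blinfun_apply T1 z)) > norm (R0 o\<^sub>L T1) - \<theta> \<Longrightarrow>
          norm (blinfun_apply T1 z - blinfun_apply T1 x) < \<kappa> \<or> norm (blinfun_apply T1 z + blinfun_apply T1 x) < \<kappa>"
      using localise[of T1 x] nT1 nx by auto
    \<comment> \<open>\<open>R\<close> is so near to \<open>R0\<close> that a vector norming \<open>R \<circ> T1\<close> is nearly norming for \<open>R0 \<circ> T1\<close>; this
      is how the localisation at \<open>x\<close> survives the use of Baire's theorem.\<close>
    have "min \<kappa> (\<theta> / 4) > 0" using \<kappa> \<theta> by simp
    from exists_all_slices_small_perturbation[OF ucY this, of R0 T1]
    obtain R where R: "norm (R - R0) < min \<kappa> (\<theta> / 4)" "\<And>\<epsilon>. \<epsilon> > 0 \<Longrightarrow> range_slices_small (R o\<^sub>L T1) \<epsilon>"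
      by blast
    define S0 where "S0 = R o\<^sub>L T1"
    have compose: "norm ((P o\<^sub>L T1) - (Q o\<^sub>L T1)) \<le> norm (P - Q)" for P Q :: "'y \<Rightarrow>\<^sub>L 'y"
      using norm_blinfun_compose[of "P - Q" T1] mult_left_mono[OF nT1 norm_ge_zero[of "P - Q"]]
      by (simp add: bounded_bilinear.diff_left[OF bounded_bilinear_blinfun_compose])
    have "norm (S0 - (R0 o\<^sub>L T1)) < \<theta> / 4" "norm (S0 - (R0 o\<^sub>L T1)) < \<kappa>"
      using compose[of R R0] R(1) by (auto simp: S0_def)
    note S0R0 = this
    have "norm ((R0 o\<^sub>L T1) - (id_blinfun o\<^sub>L T1)) \<le> \<kappa>" using compose[of R0 id_blinfun] R0 by simp
    moreover have "id_blinfun o\<^sub>L T1 = T1" by (rule blinfun_eqI) simp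
    ultimately have R0T1: "norm ((R0 o\<^sub>L T1) - T1) \<le> \<kappa>" by simp
    have S0T1: "norm (S0 - T1) \<le> 2 * \<kappa>"
      using norm_triangle_ineq[of "S0 - (R0 o\<^sub>L T1)" "(R0 o\<^sub>L T1) - T1"] S0R0 R0T1 by simp
    then have S0T: "norm (S0 - T) \<le> 3 * \<kappa>"
      using norm_triangle_ineq[of "S0 - T1" "T1 - T"] TT1 \<mu> by simp
    then have nS0: "\<bar>norm S0 - 1\<bar> \<le> 3 * \<kappa>"
      using norm_triangle_ineq3[of S0 T] nT by simp
    then have pos: "norm S0 > 0" using \<kappa> by linarith
    have S0A: "S0 o\<^sub>L proj A = S0"
    proof -
      have "S0 o\<^sub>L proj A = R o\<^sub>L (T1 o\<^sub>L proj A)" by (rule blinfun_eqI) (simp add: S0_def)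
      then show ?thesis by (simp add: T1A S0_def)
    qed
    obtain v where v: "norm v \<le> 1" "norm (blinfun_apply S0 v) = norm S0"
      using operator_attains_norm[OF att R(2)[folded S0_def] _ A(1) S0A] pos by auto
    have "norm (blinfun_apply (S0 - (R0 o\<^sub>L T1)) v) \<le> \<theta> / 4"
      using norm_blinfun_le_on_ball[OF v(1), of "S0 - (R0 o\<^sub>L T1)"] S0R0 by simp
    then have "norm S0 \<le> norm (blinfun_apply R0 (blinfun_apply T1 v)) + \<theta> / 4"
      using v(2) norm_triangle_sub[of "blinfun_apply S0 v" "blinfun_apply R0 (blinfun_apply T1 v)"]
      by (simp add: blinfun.diff_left)
    moreover have "norm (R0 o\<^sub>L T1) < norm S0 + \<theta> / 4"
      using S0R0 norm_triangle_sub[of "R0 o\<^sub>L T1" S0] by (simp add: norm_minus_commute)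
    ultimately have "norm (blinfun_apply R0 (blinfun_apply T1 v)) > norm (R0 o\<^sub>L T1) - \<theta>"
      using \<theta> by linarith
    from local[OF v(1) this] obtain z where z: "norm z \<le> 1" "norm (blinfun_apply S0 z) = norm S0"
      and T1z: "norm (blinfun_apply T1 z - blinfun_apply T1 x) < \<kappa>"
    proof
      assume "norm (blinfun_apply T1 v - blinfun_apply T1 x) < \<kappa>"
      then show ?thesis using that v by blast
    next
      assume "norm (blinfun_apply T1 v + blinfun_apply T1 x) < \<kappa>"
      then have "norm (blinfun_apply T1 (- v) - blinfun_apply T1 x) < \<kappa>"
        using norm_minus_cancel[of "blinfun_apply T1 v + blinfun_apply T1 x"] by (simp add: blinfun.minus_right)
      then show ?thesis using that[of "- v"] v by (simp add: blinfun.minus_right)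
    qed
    define S where "S = (1 / norm S0) *\<^sub>R S0"
    have nS: "norm S = 1" and Sz: "norm (blinfun_apply S z) = 1"
      using pos z by (auto simp: S_def blinfun.scaleR_left)
    have Ssmall: "range_slices_small S \<delta>" if "\<delta> > 0" for \<delta>
    proof -
      have "\<delta> * norm S0 > 0" using that pos by simp
      from range_slices_smallD[OF R(2)[folded S0_def, OF this]] obtain t where t: "t > 0"
        and near: "\<And>z z'. norm z \<le> 1 \<Longrightarrow> norm z' \<le> 1 \<Longrightarrow>
          norm (blinfun_apply S0 z) > norm S0 - t \<Longrightarrow> norm (blinfun_apply S0 z') > norm S0 - t \<Longrightarrow>
          norm (blinfun_apply S0 z - blinfun_apply S0 z') < \<delta> * norm S0 \<or>
          norm (blinfun_apply S0 z + blinfun_apply S0 z') < \<delta> * norm S0" by metis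
      show ?thesis
        unfolding range_slices_small_def
      proof (intro exI[of _ "t / norm S0"] conjI allI impI)
        show "0 < t / norm S0" using t pos by simp
        fix z z' :: 'z assume "norm z \<le> 1" "norm z' \<le> 1"
          and "norm (blinfun_apply S z) > norm S - t / norm S0" "norm (blinfun_apply S z') > norm S - t / norm S0"
        then have "norm (blinfun_apply S0 z - blinfun_apply S0 z') < \<delta> * norm S0 \<or>
          norm (blinfun_apply S0 z + blinfun_apply S0 z') < \<delta> * norm S0"
          using pos nS by (intro near) (simp_all add: S_def blinfun.scaleR_left field_simps)
        moreover have "blinfun_apply S z - blinfun_apply S z' = (1 / norm S0) *\<^sub>R (blinfun_apply S0 z - blinfun_apply S0 z')"
          and "blinfun_apply S z + blinfun_apply S z' = (1 / norm S0) *\<^sub>R (blinfun_apply S0 z + blinfun_apply S0 z')"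
          by (simp_all add: S_def blinfun.scaleR_left scaleR_diff_right scaleR_add_right)
        ultimately show "norm (blinfun_apply S z - blinfun_apply S z') < \<delta> \<or> norm (blinfun_apply S z + blinfun_apply S z') < \<delta>"
          using pos by (simp add: pos_divide_less_eq)
      qed
    qed
    have "S - S0 = (1 / norm S0 - 1) *\<^sub>R S0" by (simp add: S_def algebra_simps)
    then have "norm (S - S0) = \<bar>(1 / norm S0 - 1) * norm S0\<bar>" by (simp add: abs_mult)
    also have "(1 / norm S0 - 1) * norm S0 = 1 - norm S0" using pos by (simp add: field_simps)
    finally have SS0: "norm (S - S0) \<le> 3 * \<kappa>" using nS0 by (simp add: abs_minus_commute)
    have ST: "norm (S - T) \<le> 6 * \<kappa>"
      using norm_triangle_ineq[of "S - S0" "S0 - T"] SS0 S0T by simp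
    have ST1: "norm (S - T1) \<le> 5 * \<kappa>"
      using norm_triangle_ineq[of "S - S0" "S0 - T1"] SS0 S0T1 by simp
    have "norm (blinfun_apply S z - blinfun_apply S x) < 11 * \<kappa>"
    proof -
      have eq: "blinfun_apply S z - blinfun_apply S x =
          blinfun_apply (S - T1) z - blinfun_apply (S - T1) x + (blinfun_apply T1 z - blinfun_apply T1 x)"
        by (simp add: blinfun.diff_left)
      have "norm (blinfun_apply (S - T1) z - blinfun_apply (S - T1) x) \<le> 5 * \<kappa> + 5 * \<kappa>"
        using norm_triangle_ineq4[of "blinfun_apply (S - T1) z" "blinfun_apply (S - T1) x"] ST1
          norm_blinfun_le_on_ball[OF z(1), of "S - T1"] norm_blinfun_le_on_ball[of x "S - T1"] nx by linarith
      then show ?thesis unfolding eq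
        using norm_triangle_ineq[of "blinfun_apply (S - T1) z - blinfun_apply (S - T1) x"
            "blinfun_apply T1 z - blinfun_apply T1 x"] T1z by linarith
    qed
    moreover have "2 *\<^sub>R blinfun_apply S z = blinfun_apply S (z + x) + (blinfun_apply S z - blinfun_apply S x)"
      by (simp add: blinfun.add_right scaleR_2)
    then have "2 * norm (blinfun_apply S z) \<le> norm (blinfun_apply S (z + x)) + norm (blinfun_apply S z - blinfun_apply S x)"
      by (metis norm_triangle_ineq norm_scaleR abs_numeral)
    ultimately have "norm (blinfun_apply S (z + x)) > 2 - \<alpha>" using Sz \<kappa> by linarith
    then obtain S' x0 where S': "S' \<in> RSE" "norm x0 = 1" "norm S' = 1" "norm (blinfun_apply S' x0) = 1"
        "norm (S' - S) < \<epsilon> / 2" "norm (x - x0) < \<epsilon> / 2"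
      using relocate[OF nS _ z(1) Sz nx] Ssmall by blast
    have "norm (S' - T) < \<epsilon>"
      using norm_triangle_ineq[of "S' - S" "S - T"] S'(5) ST \<kappa> by simp
    then show "\<exists>S \<in> RSE. \<exists>x0 \<in> sphere 0 1.
          norm S = 1 \<and> norm (blinfun_apply S x0) = 1 \<and> norm (S - T) < \<epsilon> \<and> norm (x - x0) < \<epsilon>"
      using S' \<epsilon> by (intro bexI[of _ S'] bexI[of _ x0]) auto
  qed
qed

section \<open>Uniform convexity of the target space is necessary\<close>

lemma RSE_norming_values:
  fixes S :: "'z::real_normed_vector \<Rightarrow>\<^sub>L 'y::real_normed_vector"
  assumes "S \<in> RSE"
  shows "\<exists>w. \<forall>x. norm x \<le> 1 \<longrightarrow> norm (blinfun_apply S x) = norm S \<longrightarrow> blinfun_apply S x = w \<or> blinfun_apply S x = - w"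
proof -
  obtain x0 where x0: "\<And>x :: nat \<Rightarrow> 'z. range x \<subseteq> cball 0 1 \<Longrightarrow> (\<lambda>n. norm (blinfun_apply S (x n))) \<longlonglongrightarrow> norm S \<Longrightarrow>
      (\<exists>(\<sigma> :: nat \<Rightarrow> nat) (\<theta>::real). strict_mono \<sigma> \<and> \<theta> \<in> {1, -1} \<and>
        (\<lambda>n. blinfun_apply S (x (\<sigma> n))) \<longlonglongrightarrow> \<theta> *\<^sub>R blinfun_apply S x0)"
    using assms unfolding RSE_def by blast
  have "blinfun_apply S x = blinfun_apply S x0 \<or> blinfun_apply S x = - blinfun_apply S x0"
    if "norm x \<le> 1" "norm (blinfun_apply S x) = norm S" for x
    using x0[of "\<lambda>_. x"] that by (auto simp: LIMSEQ_const_iff)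
  then show ?thesis by blast
qed

text \<open>A range strongly exposing operator is constant up to sign on the vectors where it attains its norm.
  For an operator near \<open>z \<mapsto> g(z\<^sub>i) u + g(z\<^sub>j) w\<close> these contain a segment in direction \<open>j\<close>, and three
  equally spaced collinear points cannot all lie in \<open>{q, -q}\<close> unless they coincide.\<close>
lemma (in sup_coordinates) uniformly_convex_if_BPBp_RSE:
  fixes i j :: 'i
  assumes ij: "i \<noteq> j" and X: "\<exists>a :: 'x. a \<noteq> 0"
    and bpb: "BPBp_RSE TYPE('z) TYPE('y::real_normed_vector)"
  shows "uniformly_convex TYPE('y)"
  unfolding uniformly_convex_def
proof (intro allI impI)
  fix \<epsilon> :: real assume \<epsilon>: "\<epsilon> > 0"
  obtain a :: 'x where "a \<noteq> 0" using X by blast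
  define e where "e = sgn a"
  have e: "norm e = 1" using \<open>a \<noteq> 0\<close> by (simp add: e_def norm_sgn)
  obtain g :: "'x \<Rightarrow>\<^sub>L real" where g: "norm g \<le> 1" "blinfun_apply g e = 1"
    using exists_norming_functional[of e] e by auto
  have g_le: "\<bar>blinfun_apply g u\<bar> \<le> 1" if "norm u \<le> 1" for u
    using norm_blinfun_le_on_ball[OF that, of g] g by simp
  define r where "r = min (\<epsilon> / 2) (1 / 2)"
  have r: "r > 0" "r \<le> \<epsilon> / 2" "r \<le> 1 / 2" using \<epsilon> by (auto simp: r_def)
  obtain \<eta> where \<eta>: "0 < \<eta>" "\<eta> < r" and bp: "\<And>(T :: 'z \<Rightarrow>\<^sub>L 'y) x. norm T = 1 \<Longrightarrow> x \<in> sphere 0 1 \<Longrightarrow>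
        norm (blinfun_apply T x) > 1 - \<eta> \<Longrightarrow>
        (\<exists>S \<in> RSE. \<exists>x0 \<in> sphere 0 1.
          norm S = 1 \<and> norm (blinfun_apply S x0) = 1 \<and> norm (S - T) < r \<and> norm (x - x0) < r)"
    using bpb[unfolded BPBp_RSE_def, rule_format, OF r(1)] by metis
  have "norm (y1 - y2) < \<epsilon>"
    if y: "norm y1 = 1" "norm y2 = 1" and mid: "norm (y1 + y2) / 2 > 1 - \<eta>" for y1 y2 :: 'y
  proof -
    define u where "u = (1 / 2) *\<^sub>R (y1 + y2)"
    define w where "w = (1 / 2) *\<^sub>R (y1 - y2)"
    have uw: "u + w = y1" "u - w = y2"
      by (simp_all add: u_def w_def algebra_simps) (simp_all add: scaleR_2[symmetric] flip: scaleR_add_left)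
    define T where "T = (blinfun_scaleR_left u o\<^sub>L (g o\<^sub>L coord i)) + (blinfun_scaleR_left w o\<^sub>L (g o\<^sub>L coord j))"
    have T: "blinfun_apply T z = blinfun_apply g (nth z i) *\<^sub>R u + blinfun_apply g (nth z j) *\<^sub>R w" for z
      by (simp add: T_def blinfun.add_left coord_apply)
    have "norm (s *\<^sub>R u + t *\<^sub>R w) \<le> 1" if s: "\<bar>s\<bar> \<le> 1" and t: "\<bar>t\<bar> \<le> 1" for s t
    proof -
      define p where "p = (s + t) / 2"
      define q where "q = (s - t) / 2"
      have pq: "s = p + q" "t = p - q" by (simp_all add: p_def q_def field_simps)
      have "s *\<^sub>R u + t *\<^sub>R w = p *\<^sub>R y1 + q *\<^sub>R y2"
        unfolding uw[symmetric] pq by (simp add: algebra_simps)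
      then have "norm (s *\<^sub>R u + t *\<^sub>R w) \<le> \<bar>p\<bar> * norm y1 + \<bar>q\<bar> * norm y2"
        by (metis norm_triangle_ineq norm_scaleR)
      then show ?thesis using y s t by (simp add: pq abs_if split: if_splits)
    qed
    then have T_le: "norm T \<le> 1"
      by (intro norm_blinfun_le_if_ball) (simp add: T g_le[OF order_trans[OF norm_nth_le]])
    define x where "x = blinfun_apply (single i) e"
    have nx: "norm x = 1" by (simp add: x_def norm_single e)
    define d where "d = (1 / 2) *\<^sub>R blinfun_apply (single j) e"
    have nd: "norm d = 1 / 2" by (simp add: d_def norm_single e)
    have Tx: "blinfun_apply T x = u" using ij by (simp add: T x_def nth_single g)
    have Td: "blinfun_apply T d = (1 / 2) *\<^sub>R w"
      using ij by (simp add: T d_def nth_scaleR nth_single g blinfun.scaleR_right)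
    have "norm T \<ge> 1"
    proof -
      have "norm (x + 2 *\<^sub>R d) \<le> 1"
        by (rule norm_le) (use ij in \<open>simp add: nth_add nth_scaleR x_def d_def nth_single e\<close>)
      moreover have "blinfun_apply T (x + 2 *\<^sub>R d) = y1"
        by (simp add: blinfun.add_right blinfun.scaleR_right Tx Td uw)
      ultimately show ?thesis using norm_blinfun_le_on_ball[of "x + 2 *\<^sub>R d" T] y by simp
    qed
    with T_le have "norm T = 1" by simp
    moreover have "norm (blinfun_apply T x) > 1 - \<eta>" using mid by (simp add: Tx u_def)
    ultimately obtain S x0 where S: "S \<in> RSE" "norm S = 1" "norm (blinfun_apply S x0) = 1" "norm (S - T) < r"
      and x0: "norm x0 = 1" "norm (x - x0) < r"
      using bp[of T x] nx by auto
    have x0j: "norm (nth x0 j) < 1 / 2"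
      using norm_nth_le[of "x - x0" j] x0(2) r ij by (simp add: nth_diff x_def nth_single)
    \<comment> \<open>Coordinate \<open>j\<close> of \<open>x0\<close> has norm below one half, and so leaves room for \<open>d\<close>.\<close>
    have ball: "norm (x0 + s *\<^sub>R d) \<le> 1" if s: "\<bar>s\<bar> = 1" for s
    proof (rule norm_le)
      fix k
      show "norm (nth (x0 + s *\<^sub>R d) k) \<le> 1"
      proof (cases "k = j")
        case True
        have "norm (nth x0 j + (s / 2) *\<^sub>R e) \<le> norm (nth x0 j) + 1 / 2"
          using norm_triangle_ineq[of "nth x0 j" "(s / 2) *\<^sub>R e"] s e by simp
        then show ?thesis using x0j True by (simp add: nth_add nth_scaleR d_def nth_single)
      next
        case False
        then show ?thesis using norm_nth_le[of x0 k] x0(1) by (simp add: nth_add nth_scaleR d_def nth_single)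
      qed
    qed
    let ?p = "blinfun_apply S x0" and ?b = "blinfun_apply S d"
    have le: "norm (?p + ?b) \<le> 1" "norm (?p - ?b) \<le> 1"
      using norm_blinfun_le_on_ball[OF ball[of 1], of S] norm_blinfun_le_on_ball[OF ball[of "-1"], of S] S(2)
      by (simp_all add: blinfun.add_right blinfun.diff_right)
    have "2 *\<^sub>R ?p = (?p + ?b) + (?p - ?b)" by (simp add: scaleR_2)
    then have "2 * norm ?p \<le> norm (?p + ?b) + norm (?p - ?b)"
      by (metis norm_triangle_ineq norm_scaleR abs_numeral)
    then have one: "norm (?p + ?b) = 1" "norm (?p - ?b) = 1" using le S(3) by linarith+
    obtain q where q: "\<And>x. norm x \<le> 1 \<Longrightarrow> norm (blinfun_apply S x) = norm S \<Longrightarrow>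
        blinfun_apply S x = q \<or> blinfun_apply S x = - q"
      using RSE_norming_values[OF S(1)] by blast
    have p: "?p = q \<or> ?p = - q" using q[of x0] x0 S by simp
    have "?p + ?b = q \<or> ?p + ?b = - q"
      using q[OF ball[of 1]] one S by (simp add: blinfun.add_right)
    with p have plus: "?p + ?b = ?p \<or> ?p + ?b = - ?p" by (metis minus_minus)
    have "?p - ?b = q \<or> ?p - ?b = - q"
      using q[OF ball[of "-1"]] one S by (simp add: blinfun.diff_right)
    with p have minus: "?p - ?b = ?p \<or> ?p - ?b = - ?p" by (metis minus_minus)
    have "?b = 0"
    proof (rule ccontr)
      assume "?b \<noteq> 0"
      then have "?p + ?b = - ?p" "?p - ?b = - ?p" using plus minus by simp_all
      then have "(?p + ?b) + (?p - ?b) = - ?p + - ?p" by simp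
      then have "2 *\<^sub>R ?p = - (2 *\<^sub>R ?p)" by (simp add: scaleR_2)
      then have "?p = 0" by (simp only: eq_neg_iff_add_eq_0) (simp flip: scaleR_add_left)
      then show False using S(3) by simp
    qed
    then have "norm (blinfun_apply T d) = norm (blinfun_apply (S - T) d)"
      by (simp add: blinfun.diff_left)
    also have "\<dots> \<le> norm (S - T) * (1 / 2)" using norm_blinfun[of "S - T" d] nd by simp
    finally have "norm w < r" using S(4) by (simp add: Td)
    then show ?thesis using r by (simp add: w_def)
  qed
  then show "\<exists>\<delta>. 0 < \<delta> \<and> \<delta> < 1 \<and> (\<forall>y1 y2 :: 'y. y1 \<in> sphere 0 1 \<longrightarrow> y2 \<in> sphere 0 1 \<longrightarrow>
        norm (y1 + y2) / 2 > 1 - \<delta> \<longrightarrow> norm (y1 - y2) < \<epsilon>)"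
    using \<eta> r by (intro exI[of _ \<eta>]) auto
qed

section \<open>The two sequence spaces\<close>

interpretation c0: sup_coordinates c0_nth
proof
  fix a b :: "'a c0" and i j :: nat and r K :: real and x :: 'a and B :: "nat set"
  show "c0_nth (a + b) i = c0_nth a i + c0_nth b i" by (simp add: plus_c0.rep_eq)
  show "c0_nth (r *\<^sub>R a) i = r *\<^sub>R c0_nth a i" by (simp add: scaleR_c0.rep_eq)
  show "norm (c0_nth a i) \<le> norm a" by (rule norm_c0_nth_le)
  show "norm a \<le> K" if "\<And>i. norm (c0_nth a i) \<le> K" using that by (rule norm_c0_le)
  show "finite {i. r \<le> norm (c0_nth a i)}" if r: "0 < r"
  proof -
    obtain N where "\<And>n. n \<ge> N \<Longrightarrow> norm (c0_nth a n) < r"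
      using LIMSEQ_D[OF c0_nth_tendsto r, of a] by auto
    then have "{i. r \<le> norm (c0_nth a i)} \<subseteq> {..<N}" by (force simp: not_le[symmetric])
    then show ?thesis by (rule finite_subset) simp
  qed
  have "(\<lambda>i. if i \<in> B then c0_nth a i else 0) \<longlonglongrightarrow> 0"
    by (rule Lim_null_comparison[OF _ tendsto_norm_zero[OF c0_nth_tendsto[of a]]]) simp
  then show "\<exists>b. \<forall>i. c0_nth b i = (if i \<in> B then c0_nth a i else 0)"
    by (intro exI[of _ "Abs_c0 (\<lambda>i. if i \<in> B then c0_nth a i else 0)"]) (simp add: Abs_c0_inverse)
  have "(\<lambda>i. if i = j then x else 0) \<longlonglongrightarrow> 0"
    by (rule tendsto_eventually) (rule eventually_sequentiallyI[of "Suc j"], simp)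
  then show "\<exists>b. \<forall>i. c0_nth b i = (if i = j then x else 0)"
    by (intro exI[of _ "Abs_c0 (\<lambda>i. if i = j then x else 0)"]) (simp add: Abs_c0_inverse)
qed

interpretation linf: sup_coordinates "linf_nth :: ('a::real_normed_vector, 'm::finite) linf \<Rightarrow> 'm \<Rightarrow> 'a"
proof
  fix a b :: "('a, 'm) linf" and i j :: 'm and r K :: real and x :: 'a and B :: "'m set"
  show "linf_nth (a + b) i = linf_nth a i + linf_nth b i" by (simp add: plus_linf.rep_eq)
  show "linf_nth (r *\<^sub>R a) i = r *\<^sub>R linf_nth a i" by (simp add: scaleR_linf.rep_eq)
  show "norm (linf_nth a i) \<le> norm a" by (rule norm_linf_nth_le)
  show "norm a \<le> K" if "\<And>i. norm (linf_nth a i) \<le> K" using that by (rule norm_linf_le)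
  show "finite {i. r \<le> norm (linf_nth a i)}" by simp
  show "\<exists>b. \<forall>i. linf_nth b i = (if i \<in> B then linf_nth a i else 0)"
    by (intro exI[of _ "Abs_linf (\<lambda>i. if i \<in> B then linf_nth a i else 0)"]) (simp add: Abs_linf_inverse)
  show "\<exists>b. \<forall>i. linf_nth b i = (if i = j then x else 0)"
    by (intro exI[of _ "Abs_linf (\<lambda>i. if i = j then x else 0)"]) (simp add: Abs_linf_inverse)
qed

theorem theorem3p16:
  assumes "dim_at_least_two TYPE('x::banach)"
    and "dim_at_least_two TYPE('y::banach)"
    and "uniformly_convex TYPE('x)"
  shows "(BPBp_RSE TYPE('x c0) TYPE('y) \<longleftrightarrow> uniformly_convex TYPE('y)) \<and>
    (CARD('m::finite) \<ge> 2 \<longrightarrow>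
      (BPBp_RSE TYPE(('x, 'm) linf) TYPE('y) \<longleftrightarrow> uniformly_convex TYPE('y)))"
proof (intro conjI impI)
  have nonzero: "\<exists>a :: 'x. a \<noteq> 0"
  proof (rule ccontr)
    assume zero: "\<not> ?thesis"
    obtain B :: "'x set" where "card B = 2"
      using assms(1) unfolding dim_at_least_two_def by blast
    moreover have "B \<subseteq> {0}" using zero by auto
    then have "card B \<le> 1" using card_mono[of "{0}" B] by simp
    ultimately show False by simp
  qed
  note att = uniformly_convex_attains_norm[OF assms(3)]
  show "BPBp_RSE TYPE('x c0) TYPE('y) \<longleftrightarrow> uniformly_convex TYPE('y)"
    using c0.uniformly_convex_if_BPBp_RSE[OF zero_neq_one nonzero]
      c0.BPBp_RSE_if_uniformly_convex[OF att assms(3)] by blast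
  assume "CARD('m) \<ge> 2"
  then obtain i j :: 'm where "i \<noteq> j"
    by (metis UNIV_I card_2_iff' ex_card)
  then show "BPBp_RSE TYPE(('x, 'm) linf) TYPE('y) \<longleftrightarrow> uniformly_convex TYPE('y)"
    using linf.uniformly_convex_if_BPBp_RSE[OF _ nonzero]
      linf.BPBp_RSE_if_uniformly_convex[OF att assms(3)] by blast
qed

end
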